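(* Let $m,n,p,q$ be integers with $0\le m\le q$, $0\le n\le p$, let $a_i,b_j\in\mathbb{C}$ and $\alpha_i,\beta_j>0$ ($1\le i\le p$, $1\le j\le q$), and let $\Delta$, $H^{m,n}_{p,q}(z)$ and $h^*_{jl}$ be as defined in the context. Assume $$\beta_j(a_i-1-k)\ne\alpha_i(b_j+l)\qquad(i=1,\dots,n;\ j=1,\dots,m;\ k,l\in\mathbb N_0),$$ $$\beta_j(b_i+k)\ne\beta_i(b_j+l)\qquad(i\ne j;\ i,j=1,\dots,m;\ k,l\in\mathbb N_0),$$ and $\Delta\ge0$. Then the series $\sum_{j=1}^m\sum_{l=0}^\infty h^*_{jl}z^{(b_j+l)/\beta_j}$ gives the asymptotic expansion of $H^{m,n}_{p,q}(z)$ near zero, and the main terms of this asymptotic formula have the form $$H^{m,n}_{p,q}(z)=\sum_{j=1}^m\left[h^*_jz^{b_j/\beta_j}+O\!\left(z^{(b_j+1)/\beta_j}\right)\right]\qquad(z\to0),$$ where $$h^*_j\equiv h^*_{j0}=\frac1{\beta_j}\ \frac{\prod_{i=1,\,i\ne j}^m\Gamma\!\left(b_i-\frac{b_j\beta_i}{\beta_j}\right)\prod_{i=1}^n\Gamma\!\left(1-a_i+\frac{b_j\alpha_i}{\beta_j}\right)}{\prod_{i=n+1}^p\Gamma\!\left(a_i-\frac{b_j\alpha_i}{\beta_j}\right)\prod_{i=m+1}^q\Gamma\!\left(1-b_i+\frac{b_j\beta_i}{\beta_j}\right)} .$$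
   Context: $\mathbb N_0=\{0,1,2,\dots\}$. Definitions (empty products equal $1$, and $1/\Gamma$ is entire, so $1/\Gamma=0$ at the poles of $\Gamma$): $$\mathcal H(s)=\frac{\prod_{j=1}^m\Gamma(b_j+\beta_js)\ \prod_{i=1}^n\Gamma(1-a_i-\alpha_is)}{\prod_{i=n+1}^p\Gamma(a_i+\alpha_is)\ \prod_{j=m+1}^q\Gamma(1-b_j-\beta_js)},\qquad \Delta=\sum_{j=1}^q\beta_j-\sum_{i=1}^p\alpha_i,\qquad \delta=\prod_{i=1}^p\alpha_i^{-\alpha_i}\prod_{j=1}^q\beta_j^{\beta_j},$$ $$H^{m,n}_{p,q}(z)=\frac1{2\pi i}\int_{\mathfrak L_{-\infty}}\mathcal H(s)z^{-s}\,ds$$ (for $z\ne0$ if $\Delta>0$, for $0<|z|<\delta$ if $\Delta=0$). $\mathfrak L_{-\infty}$ is a loop running from $-\infty+i\varphi_1$ to $-\infty+i\varphi_2$, $\varphi_1<\varphi_2$ (consisting of the half-lines $\operatorname{Im}s=\varphi_1,\varphi_2$ for $\operatorname{Re}s$ sufficiently negative), with all poles of $\Gamma(b_j+\beta_js)$ ($1\le j\le m$) to its left (inside the loop) and all poles of $\Gamma(1-a_i-\alpha_is)$ ($1\le i\le n$) to its right (outside the loop). The coefficients are $$h^*_{jl}=\frac{(-1)^l}{l!\,\beta_j}\ \frac{\prod_{i=1,\,i\ne j}^m\Gamma\!\left(b_i-[b_j+l]\frac{\beta_i}{\beta_j}\right)\prod_{i=1}^n\Gamma\!\left(1-a_i+[b_j+l]\frac{\alpha_i}{\beta_j}\right)}{\prod_{i=n+1}^p\Gamma\!\left(a_i-[b_j+l]\frac{\alpha_i}{\beta_j}\right)\prod_{i=m+1}^q\Gamma\!\left(1-b_i+[b_j+l]\frac{\beta_i}{\beta_j}\right)}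 .$$ Powers are $z^{c}=\exp(c\log z)$ with a fixed branch of $\log z=\log|z|+i\arg z$ for which $\arg z$ stays bounded (e.g. the principal branch); $O(g(z))$ denotes a function bounded in modulus by $C|g(z)|$ for $z$ near $0$. *)

theory Defs
  imports "HOL-Complex_Analysis.Complex_Analysis" "HOL-Library.Landau_Symbols"
begin

(* A logarithm chosen at every nonzero point, with bounded argument; Ln is one instance.
   No continuity is required, since every such choice on the punctured plane has jumps. *)
definition log_branch :: "(complex \<Rightarrow> complex) \<Rightarrow> bool" where
  "log_branch lg \<longleftrightarrow>
     (\<forall>z. z \<noteq> 0 \<longrightarrow> exp (lg z) = z) \<and> (\<exists>A. \<forall>z. z \<noteq> 0 \<longrightarrow> \<bar>Im (lg z)\<bar> \<le> A)"

definition branch_pow :: "(complex \<Rightarrow> complex) \<Rightarrow> complex \<Rightarrow> complex \<Rightarrow> complex" where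
  "branch_pow lg z c = exp (c * lg z)"

(* The parameter families are indexed from 1: only a i, \<alpha> i for i in {1..p}
   and b j, \<beta> j for j in {1..q} matter.  rGamma is the entire function 1/Gamma. *)
definition fox_kernel ::
  "nat \<Rightarrow> nat \<Rightarrow> nat \<Rightarrow> nat \<Rightarrow> (nat \<Rightarrow> complex) \<Rightarrow> (nat \<Rightarrow> real) \<Rightarrow> (nat \<Rightarrow> complex) \<Rightarrow> (nat \<Rightarrow> real)
     \<Rightarrow> complex \<Rightarrow> complex" where
  "fox_kernel m n p q a \<alpha> b \<beta> s =
     (\<Prod>j=1..m. Gamma (b j + of_real (\<beta> j) * s)) *
     (\<Prod>i=1..n. Gamma (1 - a i - of_real (\<alpha> i) * s)) *
     (\<Prod>i=n+1..p. rGamma (a i + of_real (\<alpha> i) * s)) *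
     (\<Prod>j=m+1..q. rGamma (1 - b j - of_real (\<beta> j) * s))"

definition fox_Delta :: "nat \<Rightarrow> nat \<Rightarrow> (nat \<Rightarrow> real) \<Rightarrow> (nat \<Rightarrow> real) \<Rightarrow> real" where
  "fox_Delta p q \<alpha> \<beta> = (\<Sum>j=1..q. \<beta> j) - (\<Sum>i=1..p. \<alpha> i)"

definition fox_delta :: "nat \<Rightarrow> nat \<Rightarrow> (nat \<Rightarrow> real) \<Rightarrow> (nat \<Rightarrow> real) \<Rightarrow> real" where
  "fox_delta p q \<alpha> \<beta> = (\<Prod>i=1..p. \<alpha> i powr (- \<alpha> i)) * (\<Prod>j=1..q. \<beta> j powr \<beta> j)"

(* Poles of Gamma (b j + \<beta> j s), j = 1..m, and of Gamma (1 - a i - \<alpha> i s), i = 1..n. *)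
definition left_poles :: "nat \<Rightarrow> (nat \<Rightarrow> complex) \<Rightarrow> (nat \<Rightarrow> real) \<Rightarrow> complex set" where
  "left_poles m b \<beta> = {s. \<exists>j\<in>{1..m}. b j + of_real (\<beta> j) * s \<in> \<int>\<^sub>\<le>\<^sub>0}"

definition right_poles :: "nat \<Rightarrow> (nat \<Rightarrow> complex) \<Rightarrow> (nat \<Rightarrow> real) \<Rightarrow> complex set" where
  "right_poles n a \<alpha> = {s. \<exists>i\<in>{1..n}. 1 - a i - of_real (\<alpha> i) * s \<in> \<int>\<^sub>\<le>\<^sub>0}"

(* The infinite loop given by (\<phi>1, \<phi>2, R, g) comes in along Im s = \<phi>1 from -\<infinity> to Re s = R,
   follows the finite path g, and returns along Im s = \<phi>2 to -\<infinity>.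
   truncated_loop cuts it off at Re s = X and closes it by a vertical segment. *)
definition truncated_loop ::
  "real \<Rightarrow> real \<Rightarrow> real \<Rightarrow> (real \<Rightarrow> complex) \<Rightarrow> real \<Rightarrow> real \<Rightarrow> complex" where
  "truncated_loop \<phi>1 \<phi>2 R g X =
     linepath (Complex X \<phi>1) (Complex R \<phi>1) +++ g +++
     linepath (Complex R \<phi>2) (Complex X \<phi>2) +++ linepath (Complex X \<phi>2) (Complex X \<phi>1)"

(* Winding number of the infinite loop about a point off the loop: the truncations
   have the same winding number about w as soon as X < min R (Re w).  Number 1 means that
   w lies inside (to the left of the counterclockwise loop), number 0 that it lies outside. *)
definition loop_winds ::
  "real \<Rightarrow> real \<Rightarrow> real \<Rightarrow> (real \<Rightarrow> complex) \<Rightarrow> complex \<Rightarrow> complex \<Rightarrow> bool" where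
  "loop_winds \<phi>1 \<phi>2 R g w k \<longleftrightarrow>
     (\<forall>\<^sub>F X in at_bot. w \<notin> path_image (truncated_loop \<phi>1 \<phi>2 R g X) \<and>
                      winding_number (truncated_loop \<phi>1 \<phi>2 R g X) w = k)"

definition fox_loop ::
  "nat \<Rightarrow> nat \<Rightarrow> (nat \<Rightarrow> complex) \<Rightarrow> (nat \<Rightarrow> real) \<Rightarrow> (nat \<Rightarrow> complex) \<Rightarrow> (nat \<Rightarrow> real)
     \<Rightarrow> real \<Rightarrow> real \<Rightarrow> real \<Rightarrow> (real \<Rightarrow> complex) \<Rightarrow> bool" where
  "fox_loop m n a \<alpha> b \<beta> \<phi>1 \<phi>2 R g \<longleftrightarrow>
     \<phi>1 < \<phi>2 \<and> valid_path g \<and>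
     pathstart g = Complex R \<phi>1 \<and> pathfinish g = Complex R \<phi>2 \<and>
     (\<forall>w\<in>left_poles m b \<beta>. loop_winds \<phi>1 \<phi>2 R g w 1) \<and>
     (\<forall>w\<in>right_poles n a \<alpha>. loop_winds \<phi>1 \<phi>2 R g w 0)"

definition loop_integral ::
  "real \<Rightarrow> real \<Rightarrow> real \<Rightarrow> (real \<Rightarrow> complex) \<Rightarrow> (complex \<Rightarrow> complex) \<Rightarrow> complex" where
  "loop_integral \<phi>1 \<phi>2 R g f =
     integral {..R} (\<lambda>x. f (Complex x \<phi>1)) + contour_integral g f
       - integral {..R} (\<lambda>x. f (Complex x \<phi>2))"

definition fox_domain :: "nat \<Rightarrow> nat \<Rightarrow> (nat \<Rightarrow> real) \<Rightarrow> (nat \<Rightarrow> real) \<Rightarrow> complex set" where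
  "fox_domain p q \<alpha> \<beta> =
     {z. z \<noteq> 0 \<and> (fox_Delta p q \<alpha> \<beta> > 0 \<or>
                  fox_Delta p q \<alpha> \<beta> = 0 \<and> norm z < fox_delta p q \<alpha> \<beta>)}"

(* The value 0 outside fox_domain is a dummy. *)
definition fox_H ::
  "nat \<Rightarrow> nat \<Rightarrow> nat \<Rightarrow> nat \<Rightarrow> (nat \<Rightarrow> complex) \<Rightarrow> (nat \<Rightarrow> real) \<Rightarrow> (nat \<Rightarrow> complex) \<Rightarrow> (nat \<Rightarrow> real)
     \<Rightarrow> real \<Rightarrow> real \<Rightarrow> real \<Rightarrow> (real \<Rightarrow> complex) \<Rightarrow> (complex \<Rightarrow> complex) \<Rightarrow> complex \<Rightarrow> complex" where
  "fox_H m n p q a \<alpha> b \<beta> \<phi>1 \<phi>2 R g lg z =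
     (if z \<in> fox_domain p q \<alpha> \<beta>
      then 1 / (2 * of_real pi * \<i>) *
           loop_integral \<phi>1 \<phi>2 R g (\<lambda>s. fox_kernel m n p q a \<alpha> b \<beta> s * branch_pow lg z (- s))
      else 0)"

definition fox_coeff ::
  "nat \<Rightarrow> nat \<Rightarrow> nat \<Rightarrow> nat \<Rightarrow> (nat \<Rightarrow> complex) \<Rightarrow> (nat \<Rightarrow> real) \<Rightarrow> (nat \<Rightarrow> complex) \<Rightarrow> (nat \<Rightarrow> real)
     \<Rightarrow> nat \<Rightarrow> nat \<Rightarrow> complex" where
  "fox_coeff m n p q a \<alpha> b \<beta> j l =
     (-1) ^ l / (fact l * of_real (\<beta> j)) *
     (\<Prod>i\<in>{1..m}-{j}. Gamma (b i - (b j + of_nat l) * of_real (\<beta> i / \<beta> j))) *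
     (\<Prod>i=1..n. Gamma (1 - a i + (b j + of_nat l) * of_real (\<alpha> i / \<beta> j))) *
     (\<Prod>i=n+1..p. rGamma (a i - (b j + of_nat l) * of_real (\<alpha> i / \<beta> j))) *
     (\<Prod>i=m+1..q. rGamma (1 - b i + (b j + of_nat l) * of_real (\<beta> i / \<beta> j)))"

(* Asymptotic expansion in the sense of Poincare of f at 0 by the terms c i * z^(e i), i in I:
   the terms are ordered by the real parts of their exponents, finitely many below each
   bound, and after all terms of order at most |z|^M the remainder is o(|z|^M). *)
definition asymptotic_expansion_at_0 ::
  "(complex \<Rightarrow> complex) \<Rightarrow> (complex \<Rightarrow> complex) \<Rightarrow> 'i set \<Rightarrow> ('i \<Rightarrow> complex) \<Rightarrow> ('i \<Rightarrow> complex) \<Rightarrow> bool"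
where
  "asymptotic_expansion_at_0 lg f I c e \<longleftrightarrow>
     (\<forall>M::real. finite {i\<in>I. Re (e i) \<le> M} \<and>
        (\<lambda>z. norm (f z - (\<Sum>i\<in>{i\<in>I. Re (e i) \<le> M}. c i * branch_pow lg z (e i))))
          \<in> o[at 0](\<lambda>z. norm z powr M))"

end

theory Submission
  imports Defs
begin

text \<open>
  Cutting the loop at a fixed abscissa \<open>X\<close> and closing it by a vertical segment, the residue theorem
  turns the closed part into the finite sum of the terms with \<open>Re ((b\<^sub>j + l) / \<beta>\<^sub>j) < - X\<close>; what is
  left over consists of the two half-lines to the left of \<open>X\<close> and of the segment, and is
  \<open>O(|z| powr (- X))\<close>.  Since only \<open>z \<rightarrow> 0\<close> matters, this does not need the sharp growth of the kernel
  given by Stirling's formula: \<open>\<Delta> \<ge> 0\<close> yields a bound \<open>exp (C |Re s|)\<close> for it, and the factor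
  \<open>|z| powr (- Re s)\<close> wins as soon as \<open>ln |z| \<le> - C - 1\<close>.  Such a bound follows from the functional
  equation of \<open>\<Gamma>\<close>, which moves arguments into a compact set, and the reflection formula.
  If \<open>m = 0\<close>, the kernel has no poles on the left, so \<open>X\<close> may tend to \<open>-\<infinity>\<close> and the integral
  vanishes for all small \<open>z\<close>.
\<close>

section \<open>Growth of the kernel\<close>

text \<open>The poles of the factors \<open>Gamma (b j + of_real (\<beta> j) * s)\<close> run to
  -\<infinity> inside the loop, so for m > 0 there is in general no exponential bound throughout the
  strip, only on the half-lines. Even there the sines of the reflection formula must stay away from
  0. The winding condition ensures this: the poles of one factor share one imaginary part, and a
  half-line at that height would run into them. Hence also the fixed cut: on the vertical segment
  only compactness gives a bound, with no control as X varies, and X must avoid the real parts of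
  the poles. A Gamma factor grows at most like exp (c t ln t + O(t)) with t = - Re s. The
  coefficients c of all factors sum to -\<Delta>, so \<Delta> \<ge> 0 removes the superexponential
  part. The case m = 0 is separate because the formula for the main terms then has no error term
  left: H must equal an empty sum near 0, which decay faster than every power of z would not
  give.\<close>

lemma fact_ge_exp: "fact n \<ge> exp (real n * ln (real n) - real n)"
proof (cases "n = 0")
  case False
  \<comment> \<open>One term of the exponential series for e^n.\<close>
  have "real n ^ n /\<^sub>R fact n \<le> (\<Sum>k. real n ^ k /\<^sub>R fact k)"
    using sum_le_suminf[OF summable_exp_generic[of "real n"], of "{n}"] by simp
  hence "real n ^ n \<le> exp (real n) * fact n"
    by (simp add: exp_def field_simps)
  moreover have "real n ^ n = exp (real n * ln (real n))"
    using False by (simp add: exp_of_nat_mult)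
  ultimately show ?thesis
    by (simp add: exp_diff field_simps)
qed simp

lemma Re_pos_not_nonpos_Ints: "Re z > 0 \<Longrightarrow> z \<notin> \<int>\<^sub>\<le>\<^sub>0"
  by (auto elim!: nonpos_Ints_cases)

text \<open>Shifting by N moves u to a point v of a compact rectangle with 1 \<le> Re v \<le> 2,
  where both functions are bounded. The factors v + k of the Pochhammer product have modulus at most
  Re u + Y and at least k + 1, so the product lies between N! and (Re u + Y)^N.\<close>

lemma Gamma_shift_bounds:
  fixes Y :: real
  obtains K where "K > 0"
    "\<And>u. \<bar>Im u\<bar> \<le> Y \<Longrightarrow> Re u \<ge> 3 \<Longrightarrow>
       norm (Gamma u) \<le> K * exp (Re u * ln (Re u + Y))"
    "\<And>u. \<bar>Im u\<bar> \<le> Y \<Longrightarrow> Re u \<ge> 3 \<Longrightarrow>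
       norm (rGamma u) \<le> K * exp ((Re u - 1) - (Re u - 2) * ln (Re u - 2))"
proof -
  define B where "B = cbox (Complex 1 (-Y)) (Complex 2 Y)"
  have B: "u \<in> B \<longleftrightarrow> 1 \<le> Re u \<and> Re u \<le> 2 \<and> \<bar>Im u\<bar> \<le> Y" for u
    by (auto simp: B_def in_cbox_complex_iff)
  have nonpos: "u \<notin> \<int>\<^sub>\<le>\<^sub>0" if "Re u \<ge> 1" for u :: complex
    using that by (intro Re_pos_not_nonpos_Ints) linarith
  have "bounded (Gamma ` B)" "bounded (rGamma ` B)"
    unfolding B_def
    by (intro compact_imp_bounded compact_continuous_image continuous_intros compact_cbox;
        use nonpos in \<open>force simp: in_cbox_complex_iff\<close>)+
  then obtain K1 K2 where K: "K1 > 0" "\<And>u. u \<in> B \<Longrightarrow> norm (Gamma u) \<le> K1"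
      "K2 > 0" "\<And>u. u \<in> B \<Longrightarrow> norm (rGamma u) \<le> K2"
    unfolding bounded_pos by (metis imageI)
  define K where "K = max K1 K2"
  have K0: "K > 0" "\<And>u. u \<in> B \<Longrightarrow> norm (Gamma u) \<le> K" "\<And>u. u \<in> B \<Longrightarrow> norm (rGamma u) \<le> K"
    using K by (auto simp: K_def le_max_iff_disj)
  have main: "norm (Gamma u) \<le> K * exp (Re u * ln (Re u + Y)) \<and>
      norm (rGamma u) \<le> K * exp ((Re u - 1) - (Re u - 2) * ln (Re u - 2))"
    if u: "\<bar>Im u\<bar> \<le> Y" "Re u \<ge> 3" for u
  proof -
    \<comment> \<open>Subtracting 1 from the floor puts Re v in [1, 2), away from the pole of
      \<open>Gamma\<close> at 0; N then lies in (Re u - 2, Re u - 1].\<close>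
    define N where "N = nat \<lfloor>Re u\<rfloor> - 1"
    define v where "v = u - of_nat N"
    have N: "real N = of_int \<lfloor>Re u\<rfloor> - 1" using u unfolding N_def by linarith
    have N': "real N \<le> Re u - 1" "real N > Re u - 2" unfolding N by linarith+
    have v: "v \<in> B" unfolding B v_def using u N by (auto; linarith)
    have u_eq: "u = v + of_nat N" by (simp add: v_def)
    have vn: "v \<notin> \<int>\<^sub>\<le>\<^sub>0" using v nonpos B by blast
    have Y: "Y \<ge> 0" using u by linarith
    have G: "Gamma u = pochhammer v N * Gamma v"
      using pochhammer_Gamma[OF vn, of N] vn unfolding u_eq
      by (simp add: Gamma_eq_zero_iff field_simps)
    have poch: "norm (pochhammer v N) = (\<Prod>k<N. norm (v + of_nat k))"
      by (simp add: pochhammer_prod prod_norm atLeast0LessThan)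
    have "(\<Prod>k<N. norm (v + of_nat k)) \<le> (\<Prod>k<N. Re u + Y)"
    proof (intro prod_mono conjI norm_ge_zero)
      fix k assume "k \<in> {..<N}"
      hence k: "real k \<le> real N - 1" by auto
      have "norm (v + of_nat k) \<le> \<bar>Re (v + of_nat k)\<bar> + \<bar>Im (v + of_nat k)\<bar>"
        by (rule cmod_le)
      also have "\<dots> \<le> Re u + Y"
        using v B k u_eq by auto
      finally show "norm (v + of_nat k) \<le> Re u + Y" .
    qed
    also have "\<dots> = exp (real N * ln (Re u + Y))"
      using u Y by (simp add: exp_of_nat_mult)
    also have "\<dots> \<le> exp (Re u * ln (Re u + Y))"
      using u Y N' by (auto intro!: mult_right_mono)
    finally have 1: "norm (pochhammer v N) \<le> exp (Re u * ln (Re u + Y))" using poch by simp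
    have "norm (Gamma u) \<le> exp (Re u * ln (Re u + Y)) * K"
      unfolding G norm_mult by (intro mult_mono 1 K0 v) auto
    moreover have "norm (rGamma u) \<le> K * exp ((Re u - 1) - (Re u - 2) * ln (Re u - 2))"
    proof -
      have "fact N = (\<Prod>k<N. real (Suc k))"
        by (simp add: fact_prod_Suc atLeast0LessThan)
      also have "\<dots> \<le> (\<Prod>k<N. norm (v + of_nat k))"
      proof (intro prod_mono conjI)
        fix k
        have "real (Suc k) \<le> Re (v + of_nat k)" using v B by auto
        also have "\<dots> \<le> norm (v + of_nat k)" by (rule complex_Re_le_cmod)
        finally show "real (Suc k) \<le> norm (v + of_nat k)" .
      qed auto
      finally have f: "fact N \<le> norm (pochhammer v N)" using poch by simp
      \<comment> \<open>Re u \<ge> 3 gives Re u - 2 \<ge> 1, and x ln x increases from there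
        on.\<close>
      have "(Re u - 2) * ln (Re u - 2) \<le> real N * ln (real N)"
        using u N' by (intro mult_mono) auto
      hence "exp ((Re u - 2) * ln (Re u - 2) - (Re u - 1)) \<le> exp (real N * ln (real N) - real N)"
        using N' by simp
      also have "\<dots> \<le> fact N" by (rule fact_ge_exp)
      finally have p: "exp ((Re u - 2) * ln (Re u - 2) - (Re u - 1)) \<le> norm (pochhammer v N)"
        using f by simp
      have "norm (rGamma v) = norm (pochhammer v N) * norm (rGamma u)"
        using pochhammer_rGamma[of v N] u_eq by (simp add: norm_mult)
      hence "exp ((Re u - 2) * ln (Re u - 2) - (Re u - 1)) * norm (rGamma u) \<le> K"
        using K0(3)[OF v] mult_right_mono[OF p, of "norm (rGamma u)"] by simp
      thus ?thesis by (simp add: exp_diff field_simps)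
    qed
    ultimately show ?thesis by (simp add: mult.commute)
  qed
  show thesis using that[of K] K0(1) main by blast
qed

text \<open>Bounds are uniform over the points of D on a vertical line. Only the coefficient c of t
  ln t is tracked: it is additive under products, while constants, powers of t and exponential
  factors disappear in C.\<close>

definition left_growth :: "complex set \<Rightarrow> real \<Rightarrow> (complex \<Rightarrow> complex) \<Rightarrow> bool" where
  "left_growth D c f \<longleftrightarrow> (\<exists>C. \<forall>\<^sub>F t in at_top. \<forall>s\<in>D. Re s = -t \<longrightarrow>
     norm (f s) \<le> exp (C * t + c * t * ln t))"

lemma left_growth_bounded:
  assumes "\<And>s. s \<in> D \<Longrightarrow> norm (f s) \<le> K"
  shows "left_growth D 0 f"
  unfolding left_growth_def
proof (intro exI)
  have "\<forall>\<^sub>F t::real in at_top. K \<le> exp (1 * t + 0 * t * ln t)"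
    by simp real_asymp
  thus "\<forall>\<^sub>F t in at_top. \<forall>s\<in>D. Re s = -t \<longrightarrow> norm (f s) \<le> exp (1 * t + 0 * t * ln t)"
    by eventually_elim (use assms in force)
qed

lemma left_growth_mult:
  assumes "left_growth D c f" "left_growth D d g"
  shows "left_growth D (c + d) (\<lambda>s. f s * g s)"
proof -
  obtain C1 where 1: "\<forall>\<^sub>F t in at_top. \<forall>s\<in>D. Re s = -t \<longrightarrow> norm (f s) \<le> exp (C1 * t + c * t * ln t)"
    using assms(1) unfolding left_growth_def by blast
  obtain C2 where 2: "\<forall>\<^sub>F t in at_top. \<forall>s\<in>D. Re s = -t \<longrightarrow> norm (g s) \<le> exp (C2 * t + d * t * ln t)"
    using assms(2) unfolding left_growth_def by blast
  have "\<forall>\<^sub>F t in at_top. \<forall>s\<in>D. Re s = -t \<longrightarrow>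
      norm (f s * g s) \<le> exp ((C1 + C2) * t + (c + d) * t * ln t)"
    using 1 2
  proof eventually_elim
    case (elim t)
    show ?case
    proof (intro ballI impI)
      fix s assume s: "s \<in> D" "Re s = -t"
      have "norm (f s * g s) \<le> exp (C1 * t + c * t * ln t) * exp (C2 * t + d * t * ln t)"
        unfolding norm_mult using elim s by (intro mult_mono) auto
      also have "\<dots> = exp ((C1 + C2) * t + (c + d) * t * ln t)"
        by (simp add: algebra_simps flip: exp_add)
      finally show "norm (f s * g s) \<le> exp ((C1 + C2) * t + (c + d) * t * ln t)" .
    qed
  qed
  thus ?thesis unfolding left_growth_def by blast
qed

lemma left_growth_prod:
  assumes "finite I" "\<And>i. i \<in> I \<Longrightarrow> left_growth D (c i) (f i)"
  shows "left_growth D (\<Sum>i\<in>I. c i) (\<lambda>s. \<Prod>i\<in>I. f i s)"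
  using assms
proof (induction I rule: finite_induct)
  case empty
  show ?case by simp (rule left_growth_bounded[where K = 1], simp)
qed (auto intro!: left_growth_mult)

lemma left_growth_Gamma:
  assumes "\<alpha> > 0" and Y: "\<And>s. s \<in> D \<Longrightarrow> \<bar>Im s\<bar> \<le> Y"
  shows "left_growth D \<alpha> (\<lambda>s. Gamma (A - of_real \<alpha> * s))"
    and "left_growth D (-\<alpha>) (\<lambda>s. rGamma (A - of_real \<alpha> * s))"
proof -
  define Z where "Z = \<bar>Im A\<bar> + \<alpha> * \<bar>Y\<bar>"
  have Z: "\<bar>Im (A - of_real \<alpha> * s)\<bar> \<le> Z" if "s \<in> D" for s
  proof -
    have "\<bar>\<alpha> * Im s\<bar> \<le> \<alpha> * \<bar>Y\<bar>"
      using assms(1) Y[OF that] by (auto simp: abs_mult)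
    thus ?thesis unfolding Z_def by simp
  qed
  obtain K where K: "K > 0"
    "\<And>u. \<bar>Im u\<bar> \<le> Z \<Longrightarrow> Re u \<ge> 3 \<Longrightarrow> norm (Gamma u) \<le> K * exp (Re u * ln (Re u + Z))"
    "\<And>u. \<bar>Im u\<bar> \<le> Z \<Longrightarrow> Re u \<ge> 3 \<Longrightarrow>
       norm (rGamma u) \<le> K * exp ((Re u - 1) - (Re u - 2) * ln (Re u - 2))"
    using Gamma_shift_bounds[of Z] by blast
  define r where "r = Re A"
  have ev3: "\<forall>\<^sub>F t in at_top. r + \<alpha> * t \<ge> 3" using assms(1) by real_asymp
  have ev0: "\<forall>\<^sub>F t::real in at_top. t > 0" by real_asymp
  \<comment> \<open>\<alpha> ln \<alpha> is the linear coefficient of (r + \<alpha> t) ln (r +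
    \<alpha> t + Z) once \<alpha> t ln t is removed; the extra 1 turns the limit into an eventual
    bound.\<close>
  define C1 where "C1 = \<alpha> * ln \<alpha> + 1"
  have "((\<lambda>t. (ln K + (r + \<alpha> * t) * ln (r + \<alpha> * t + Z) - \<alpha> * t * ln t) / t) \<longlongrightarrow> \<alpha> * ln \<alpha>) at_top"
    using assms(1) by real_asymp
  hence "\<forall>\<^sub>F t in at_top. (ln K + (r + \<alpha> * t) * ln (r + \<alpha> * t + Z) - \<alpha> * t * ln t) / t < C1"
    by (rule order_tendstoD) (simp add: C1_def)
  hence "\<forall>\<^sub>F t in at_top. \<forall>s\<in>D. Re s = -t \<longrightarrow>
      norm (Gamma (A - of_real \<alpha> * s)) \<le> exp (C1 * t + \<alpha> * t * ln t)"
    using ev3 ev0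
  proof eventually_elim
    case (elim t)
    show ?case
    proof (intro ballI impI)
      fix s assume s: "s \<in> D" "Re s = -t"
      have "norm (Gamma (A - of_real \<alpha> * s)) \<le> K * exp ((r + \<alpha> * t) * ln (r + \<alpha> * t + Z))"
        using K(2)[OF Z[OF s(1)]] s elim by (simp add: r_def)
      also have "\<dots> = exp (ln K + (r + \<alpha> * t) * ln (r + \<alpha> * t + Z))"
        using K(1) by (simp add: exp_add)
      also have "\<dots> \<le> exp (C1 * t + \<alpha> * t * ln t)"
        using elim by (simp add: field_simps)
      finally show "norm (Gamma (A - of_real \<alpha> * s)) \<le> exp (C1 * t + \<alpha> * t * ln t)" .
    qed
  qed
  thus "left_growth D \<alpha> (\<lambda>s. Gamma (A - of_real \<alpha> * s))"
    unfolding left_growth_def by blast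
  \<comment> \<open>For the reciprocal the logarithmic part changes sign; the additional \<alpha>
    comes from the factor e^N in N! \<ge> (N/e)^N.\<close>
  define C2 where "C2 = \<alpha> - \<alpha> * ln \<alpha> + 1"
  have "((\<lambda>t. (ln K + ((r + \<alpha> * t - 1) - (r + \<alpha> * t - 2) * ln (r + \<alpha> * t - 2)) + \<alpha> * t * ln t) / t)
          \<longlongrightarrow> \<alpha> - \<alpha> * ln \<alpha>) at_top"
    using assms(1) by real_asymp
  hence "\<forall>\<^sub>F t in at_top. (ln K + ((r + \<alpha> * t - 1) - (r + \<alpha> * t - 2) * ln (r + \<alpha> * t - 2))
      + \<alpha> * t * ln t) / t < C2"
    by (rule order_tendstoD) (simp add: C2_def)
  hence "\<forall>\<^sub>F t in at_top. \<forall>s\<in>D. Re s = -t \<longrightarrow>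
      norm (rGamma (A - of_real \<alpha> * s)) \<le> exp (C2 * t + (-\<alpha>) * t * ln t)"
    using ev3 ev0
  proof eventually_elim
    case (elim t)
    show ?case
    proof (intro ballI impI)
      fix s assume s: "s \<in> D" "Re s = -t"
      have "norm (rGamma (A - of_real \<alpha> * s)) \<le>
          K * exp ((r + \<alpha> * t - 1) - (r + \<alpha> * t - 2) * ln (r + \<alpha> * t - 2))"
        using K(3)[OF Z[OF s(1)]] s elim by (simp add: r_def)
      also have "\<dots> = exp (ln K + ((r + \<alpha> * t - 1) - (r + \<alpha> * t - 2) * ln (r + \<alpha> * t - 2)))"
        using K(1) by (simp add: exp_add)
      also have "\<dots> \<le> exp (C2 * t + (-\<alpha>) * t * ln t)"
        using elim by (simp add: field_simps)
      finally show "norm (rGamma (A - of_real \<alpha> * s)) \<le> exp (C2 * t + (-\<alpha>) * t * ln t)" .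
    qed
  qed
  thus "left_growth D (-\<alpha>) (\<lambda>s. rGamma (A - of_real \<alpha> * s))"
    unfolding left_growth_def by blast
qed

lemma left_growth_mono:
  assumes "left_growth D c g"
    and "\<forall>\<^sub>F t in at_top. \<forall>s\<in>D. Re s = -t \<longrightarrow> norm (f s) \<le> norm (g s)"
  shows "left_growth D c f"
proof -
  obtain C where "\<forall>\<^sub>F t in at_top. \<forall>s\<in>D. Re s = -t \<longrightarrow> norm (g s) \<le> exp (C * t + c * t * ln t)"
    using assms(1) unfolding left_growth_def by blast
  with assms(2) have "\<forall>\<^sub>F t in at_top. \<forall>s\<in>D. Re s = -t \<longrightarrow> norm (f s) \<le> exp (C * t + c * t * ln t)"
    by eventually_elim force
  thus ?thesis unfolding left_growth_def by blast
qed

section \<open>Reflection to the left half-plane\<close>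

lemma norm_sin_le_exp: "norm (sin z :: complex) \<le> exp \<bar>Im z\<bar>"
proof -
  have "norm (sin z) = norm (exp (\<i> * z) - exp (- (\<i> * z))) / 2"
    by (simp add: sin_exp_eq norm_divide norm_mult)
  also have "\<dots> \<le> (norm (exp (\<i> * z)) + norm (exp (- (\<i> * z)))) / 2"
    by (intro divide_right_mono norm_triangle_ineq4) auto
  also have "\<dots> = (exp (- Im z) + exp (Im z)) / 2" by simp
  also have "\<dots> \<le> (exp \<bar>Im z\<bar> + exp \<bar>Im z\<bar>) / 2"
    by (intro divide_right_mono add_mono) auto
  finally show ?thesis by simp
qed

text \<open>The bound is |sinh (Im z)|, a positive constant along every horizontal line off the real
  axis.\<close>

lemma norm_sin_ge: "norm (sin z :: complex) \<ge> \<bar>exp (Im z) - exp (- Im z)\<bar> / 2"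
proof -
  have "norm (sin z) = norm (exp (\<i> * z) - exp (- (\<i> * z))) / 2"
    by (simp add: sin_exp_eq norm_divide norm_mult)
  moreover have "\<bar>norm (exp (\<i> * z)) - norm (exp (- (\<i> * z)))\<bar> \<le> norm (exp (\<i> * z) - exp (- (\<i> * z)))"
    by (rule norm_triangle_ineq3)
  ultimately show ?thesis by simp
qed

text \<open>By reflection rGamma u = sin (pi u) / pi * Gamma (1 - u). The sine is bounded in a
  strip, and 1 - u moves to the right, where the direct estimate applies.\<close>

lemma left_growth_rGamma_reflected:
  assumes "\<alpha> > 0" and Y: "\<And>s. s \<in> D \<Longrightarrow> \<bar>Im s\<bar> \<le> Y"
  shows "left_growth D \<alpha> (\<lambda>s. rGamma (A + of_real \<alpha> * s))"
proof -
  define K where "K = exp (pi * (\<bar>Im A\<bar> + \<alpha> * \<bar>Y\<bar>))"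
  have sin: "norm (sin (of_real pi * (A + of_real \<alpha> * s)) / of_real pi) \<le> K" if "s \<in> D" for s
  proof -
    have "\<bar>\<alpha> * Im s\<bar> \<le> \<alpha> * \<bar>Y\<bar>"
      using assms(1) Y[OF that] by (auto simp: abs_mult)
    hence "\<bar>Im A + \<alpha> * Im s\<bar> \<le> \<bar>Im A\<bar> + \<alpha> * \<bar>Y\<bar>" by linarith
    hence "\<bar>Im (of_real pi * (A + of_real \<alpha> * s))\<bar> \<le> pi * (\<bar>Im A\<bar> + \<alpha> * \<bar>Y\<bar>)"
      by (simp add: abs_mult)
    hence "norm (sin (of_real pi * (A + of_real \<alpha> * s))) \<le> K"
      unfolding K_def by (intro order.trans[OF norm_sin_le_exp]) simp
    moreover have "K \<le> K * pi" using pi_ge_two by (simp add: K_def)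
    ultimately show ?thesis using pi_gt_zero by (simp add: norm_divide field_simps)
  qed
  have "left_growth D (0 + \<alpha>) (\<lambda>s. sin (of_real pi * (A + of_real \<alpha> * s)) / of_real pi *
          Gamma ((1 - A) - of_real \<alpha> * s))"
    using assms sin by (intro left_growth_mult left_growth_Gamma[of \<alpha> D Y] left_growth_bounded) auto
  moreover have "\<forall>\<^sub>F t in at_top. \<forall>s\<in>D. Re s = -t \<longrightarrow> norm (rGamma (A + of_real \<alpha> * s)) \<le>
      norm (sin (of_real pi * (A + of_real \<alpha> * s)) / of_real pi * Gamma ((1 - A) - of_real \<alpha> * s))"
  proof -
    have "\<forall>\<^sub>F t in at_top. Re (1 - A) + \<alpha> * t > 0" using assms(1) by real_asymp
    thus ?thesis
    proof eventually_elim
      case (elim t)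
      show ?case
      proof (intro ballI impI)
        fix s assume s: "s \<in> D" "Re s = -t"
        define u where "u = A + of_real \<alpha> * s"
        have eq: "(1 - A) - of_real \<alpha> * s = 1 - u" by (simp add: u_def)
        have "Re (1 - u) > 0" using elim s by (simp add: u_def)
        hence "1 - u \<notin> \<int>\<^sub>\<le>\<^sub>0" by (rule Re_pos_not_nonpos_Ints)
        hence "rGamma (1 - u) * Gamma (1 - u) = 1"
          by (simp add: rGamma_inverse_Gamma Gamma_eq_zero_iff)
        hence "rGamma u = (rGamma u * rGamma (1 - u)) * Gamma (1 - u)"
          by (simp add: mult.assoc)
        hence "rGamma u = sin (of_real pi * u) / of_real pi * Gamma (1 - u)"
          unfolding rGamma_reflection_complex .
        thus "norm (rGamma (A + of_real \<alpha> * s)) \<le>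
          norm (sin (of_real pi * (A + of_real \<alpha> * s)) / of_real pi * Gamma ((1 - A) - of_real \<alpha> * s))"
          unfolding eq u_def[symmetric] by simp
      qed
    qed
  qed
  ultimately show ?thesis using left_growth_mono[where c = \<alpha>] by simp
qed

text \<open>Here the sine stands in the denominator and vanishes at the poles of
  \<open>Gamma\<close>, hence the lower bound \<epsilon> on D as a hypothesis.\<close>

lemma left_growth_Gamma_reflected:
  assumes "\<beta> > 0" and Y: "\<And>s. s \<in> D \<Longrightarrow> \<bar>Im s\<bar> \<le> Y" and "\<epsilon> > 0"
    and sin: "\<And>s. s \<in> D \<Longrightarrow> norm (sin (of_real pi * (B + of_real \<beta> * s))) \<ge> \<epsilon>"
  shows "left_growth D (-\<beta>) (\<lambda>s. Gamma (B + of_real \<beta> * s))"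
proof -
  have sin': "norm (of_real pi / sin (of_real pi * (B + of_real \<beta> * s))) \<le> pi / \<epsilon>" if "s \<in> D" for s
    using sin[OF that] \<open>\<epsilon> > 0\<close> by (auto simp: norm_divide intro!: divide_left_mono mult_pos_pos)
  have "left_growth D (0 + -\<beta>) (\<lambda>s. of_real pi / sin (of_real pi * (B + of_real \<beta> * s)) *
          rGamma ((1 - B) - of_real \<beta> * s))"
    using assms(1) Y sin' by (intro left_growth_mult left_growth_Gamma[of \<beta> D Y] left_growth_bounded) auto
  moreover have "\<forall>\<^sub>F t in at_top. \<forall>s\<in>D. Re s = -t \<longrightarrow> norm (Gamma (B + of_real \<beta> * s)) \<le>
      norm (of_real pi / sin (of_real pi * (B + of_real \<beta> * s)) * rGamma ((1 - B) - of_real \<beta> * s))"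
  proof (intro always_eventually allI ballI impI)
    fix t s assume s: "s \<in> D"
    define u where "u = B + of_real \<beta> * s"
    have eq: "(1 - B) - of_real \<beta> * s = 1 - u" by (simp add: u_def)
    have "sin (of_real pi * u) \<noteq> 0" using sin[OF s] \<open>\<epsilon> > 0\<close> unfolding u_def by fastforce
    moreover from this have "rGamma u \<noteq> 0" using rGamma_reflection_complex[of u] by auto
    ultimately have "Gamma u = of_real pi / sin (of_real pi * u) * rGamma (1 - u)"
      using rGamma_reflection_complex[of u] by (simp add: Gamma_def divide_simps) (simp add: mult_ac)
    thus "norm (Gamma (B + of_real \<beta> * s)) \<le>
      norm (of_real pi / sin (of_real pi * (B + of_real \<beta> * s)) * rGamma ((1 - B) - of_real \<beta> * s))"
      unfolding eq u_def[symmetric] by simp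
  qed
  ultimately show ?thesis using left_growth_mono[where c = "-\<beta>"] by simp
qed

text \<open>Each b-factor contributes -\<beta> j and each a-factor \<alpha> i, whether it stands as
  \<open>Gamma\<close> or as \<open>rGamma\<close>, so the total is -\<Delta> for all m and n. Only
  the factors with poles on the left need the sine condition.\<close>

lemma left_growth_fox_kernel:
  assumes mn: "m \<le> q" "n \<le> p"
    and \<alpha>: "\<And>i. i \<in> {1..p} \<Longrightarrow> \<alpha> i > 0"
    and \<beta>: "\<And>j. j \<in> {1..q} \<Longrightarrow> \<beta> j > 0"
    and Y: "\<And>s. s \<in> D \<Longrightarrow> \<bar>Im s\<bar> \<le> Y"
    and sin: "\<And>j. j \<in> {1..m} \<Longrightarrow>
        \<exists>\<epsilon>>0. \<forall>s\<in>D. norm (sin (of_real pi * (b j + of_real (\<beta> j) * s))) \<ge> \<epsilon>"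
  shows "left_growth D (- fox_Delta p q \<alpha> \<beta>) (fox_kernel m n p q a \<alpha> b \<beta>)"
proof -
  have "left_growth D ((\<Sum>j=1..m. - \<beta> j) + (\<Sum>i=1..n. \<alpha> i) + (\<Sum>i=n+1..p. \<alpha> i) + (\<Sum>j=m+1..q. - \<beta> j))
     (fox_kernel m n p q a \<alpha> b \<beta>)"
    unfolding fox_kernel_def
  proof (intro left_growth_mult left_growth_prod finite_atLeastAtMost)
    fix j assume j: "j \<in> {1..m}"
    then obtain \<epsilon> where "\<epsilon> > 0" "\<forall>s\<in>D. norm (sin (of_real pi * (b j + of_real (\<beta> j) * s))) \<ge> \<epsilon>"
      using sin by blast
    thus "left_growth D (- \<beta> j) (\<lambda>s. Gamma (b j + of_real (\<beta> j) * s))"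
      using j mn by (intro left_growth_Gamma_reflected[where Y = Y and \<epsilon> = \<epsilon>] \<beta> Y) auto
  qed (use mn in \<open>auto intro!: left_growth_rGamma_reflected[where Y = Y] left_growth_Gamma[where Y = Y] \<alpha> \<beta> Y\<close>)
  also have "(\<Sum>j=1..m. - \<beta> j) + (\<Sum>i=1..n. \<alpha> i) + (\<Sum>i=n+1..p. \<alpha> i) + (\<Sum>j=m+1..q. - \<beta> j) =
      ((\<Sum>i=1..n. \<alpha> i) + (\<Sum>i=n+1..p. \<alpha> i)) - ((\<Sum>j=1..m. \<beta> j) + (\<Sum>j=m+1..q. \<beta> j))"
    by (simp add: sum_negf)
  also have "\<dots> = - fox_Delta p q \<alpha> \<beta>"
    using mn sum.ub_add_nat[of 1 n \<alpha> "p - n"] sum.ub_add_nat[of 1 m \<beta> "q - m"]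
    by (simp add: fox_Delta_def)
  finally show ?thesis .
qed

lemma fox_kernel_left_bound:
  assumes "m \<le> q" "n \<le> p"
    and "\<And>i. i \<in> {1..p} \<Longrightarrow> \<alpha> i > 0"
    and "\<And>j. j \<in> {1..q} \<Longrightarrow> \<beta> j > 0"
    and "fox_Delta p q \<alpha> \<beta> \<ge> 0"
    and "\<And>s. s \<in> D \<Longrightarrow> \<bar>Im s\<bar> \<le> Y"
    and "\<And>j. j \<in> {1..m} \<Longrightarrow>
        \<exists>\<epsilon>>0. \<forall>s\<in>D. norm (sin (of_real pi * (b j + of_real (\<beta> j) * s))) \<ge> \<epsilon>"
  shows "\<exists>C X0. \<forall>s\<in>D. Re s \<le> X0 \<longrightarrow> norm (fox_kernel m n p q a \<alpha> b \<beta> s) \<le> exp (- C * Re s)"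
proof -
  define \<Delta> where "\<Delta> = fox_Delta p q \<alpha> \<beta>"
  obtain C where "\<forall>\<^sub>F t in at_top. \<forall>s\<in>D. Re s = -t \<longrightarrow>
      norm (fox_kernel m n p q a \<alpha> b \<beta> s) \<le> exp (C * t + (-\<Delta>) * t * ln t)"
  proof -
    have "left_growth D (-\<Delta>) (fox_kernel m n p q a \<alpha> b \<beta>)"
      unfolding \<Delta>_def by (rule left_growth_fox_kernel) (use assms in auto)
    thus thesis using that unfolding left_growth_def by blast
  qed
  hence "\<forall>\<^sub>F t in at_top. \<forall>s\<in>D. Re s = -t \<longrightarrow>
      norm (fox_kernel m n p q a \<alpha> b \<beta> s) \<le> exp (C * t)"
    using eventually_ge_at_top[of 1]
  proof eventually_elim
    case (elim t)
    \<comment> \<open>The sign of \<Delta> disposes of the superexponential term as soon as ln t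
      \<ge> 0.\<close>
    have "\<Delta> * t * ln t \<ge> 0" using elim assms(5) by (simp add: \<Delta>_def)
    hence "exp (C * t + (-\<Delta>) * t * ln t) \<le> exp (C * t)" by simp
    thus ?case using elim by (meson order_trans)
  qed
  then obtain T where "\<And>t s. t \<ge> T \<Longrightarrow> s \<in> D \<Longrightarrow> Re s = -t \<Longrightarrow>
      norm (fox_kernel m n p q a \<alpha> b \<beta> s) \<le> exp (C * t)"
    unfolding eventually_at_top_linorder by blast
  from this[of "- Re s" s for s] show ?thesis by (intro exI[of _ C] exI[of _ "-T"]) auto
qed

section \<open>Truncated loops\<close>

lemma contour_integral_horizontal:
  assumes "x0 < x1"
  shows "contour_integral (linepath (Complex x0 y) (Complex x1 y)) f =
           integral {x0..x1} (\<lambda>x. f (Complex x y))"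
proof -
  have "contour_integral (linepath (Complex x0 y) (Complex x1 y)) f =
      of_real (x1 - x0) * integral {0..1} (\<lambda>x. f (linepath (Complex x0 y) (Complex x1 y) x))"
    by (simp add: contour_integral_integral complex_eq_iff)
  also have "integral {0..1} (\<lambda>x. f (linepath (Complex x0 y) (Complex x1 y) x)) =
      integral {0..1} (\<lambda>x. f (Complex ((x1 - x0) * x + x0) y))"
    by (intro integral_cong arg_cong[of _ _ f]) (auto simp: linepath_def complex_eq_iff algebra_simps)
  also have "{0..1} = (\<lambda>x. x / (x1 - x0)) ` {x0 - x0..x1 - x0}"
    using assms by simp
  also have "integral \<dots> (\<lambda>x. f (Complex ((x1 - x0) * x + x0) y)) =
      integral {x0 - x0..x1 - x0} (\<lambda>x. f (Complex (x + x0) y)) / of_real (x1 - x0)"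
    using assms by (subst integral_stretch_real) (auto simp: scaleR_conv_of_real)
  also have "\<dots> = integral {x0..x1} (\<lambda>x. f (Complex x y)) / of_real (x1 - x0)"
    by (subst integral_shift_real_ivl) (rule refl)
  finally show ?thesis using assms by simp
qed

lemma closed_segment_horizontal:
  "closed_segment (Complex x0 y) (Complex x1 y) = {s. Im s = y \<and> Re s \<in> closed_segment x0 x1}"
  by (subst closed_segment_same_Im) auto

lemma closed_segment_vertical:
  "closed_segment (Complex x y0) (Complex x y1) = {s. Re s = x \<and> Im s \<in> closed_segment y0 y1}"
  by (subst closed_segment_same_Re) auto

lemma truncated_loop_simps:
  assumes "valid_path g" "pathstart g = Complex R \<phi>1" "pathfinish g = Complex R \<phi>2"
  shows "valid_path (truncated_loop \<phi>1 \<phi>2 R g X)"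
    and "pathfinish (truncated_loop \<phi>1 \<phi>2 R g X) = pathstart (truncated_loop \<phi>1 \<phi>2 R g X)"
    and "path_image (truncated_loop \<phi>1 \<phi>2 R g X) =
      closed_segment (Complex X \<phi>1) (Complex R \<phi>1) \<union> path_image g \<union>
      closed_segment (Complex R \<phi>2) (Complex X \<phi>2) \<union> closed_segment (Complex X \<phi>2) (Complex X \<phi>1)"
  using assms by (auto simp: truncated_loop_def path_image_join)

lemma contour_integral_truncated_loop:
  assumes g: "valid_path g" "pathstart g = Complex R \<phi>1" "pathfinish g = Complex R \<phi>2"
    and S: "open S" "f holomorphic_on S" "path_image (truncated_loop \<phi>1 \<phi>2 R g X) \<subseteq> S"
  shows "contour_integral (truncated_loop \<phi>1 \<phi>2 R g X) f =
    contour_integral (linepath (Complex X \<phi>1) (Complex R \<phi>1)) f + contour_integral g f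
    - contour_integral (linepath (Complex X \<phi>2) (Complex R \<phi>2)) f
    - contour_integral (linepath (Complex X \<phi>1) (Complex X \<phi>2)) f"
proof -
  have sub: "closed_segment (Complex X \<phi>1) (Complex R \<phi>1) \<subseteq> S" "path_image g \<subseteq> S"
      "closed_segment (Complex R \<phi>2) (Complex X \<phi>2) \<subseteq> S"
      "closed_segment (Complex X \<phi>2) (Complex X \<phi>1) \<subseteq> S"
    using S(3) unfolding truncated_loop_simps(3)[OF g] by auto
  have int: "f contour_integrable_on linepath u v" if "closed_segment u v \<subseteq> S" for u v
    using that S holomorphic_on_imp_continuous_on continuous_on_subset
    by (blast intro: contour_integrable_continuous_linepath)
  have g': "f contour_integrable_on g"
    using S(2,1) g(1) sub(2) by (rule contour_integrable_holomorphic_simple)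
  have rev: "contour_integral (linepath u v) f = - contour_integral (linepath v u) f"
    if "closed_segment u v \<subseteq> S" for u v
    using that S holomorphic_on_imp_continuous_on continuous_on_subset
    by (blast intro: contour_integral_reverse_linepath)
  show ?thesis
    unfolding truncated_loop_def using g g' sub int rev
    by (simp add: rev[OF sub(3)] rev[OF sub(4)])
qed

text \<open>Cauchy's theorem for a rectangle, arranged as two routes from the corner (X', \<phi>1)
  to the corner (X, \<phi>2).\<close>

lemma contour_integral_rectangle:
  assumes "convex S" "f holomorphic_on S"
    and "Complex X' \<phi>1 \<in> S" "Complex X \<phi>1 \<in> S" "Complex X \<phi>2 \<in> S" "Complex X' \<phi>2 \<in> S"
  shows "contour_integral (linepath (Complex X' \<phi>1) (Complex X \<phi>1)) f
         + contour_integral (linepath (Complex X \<phi>1) (Complex X \<phi>2)) f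
         = contour_integral (linepath (Complex X' \<phi>1) (Complex X' \<phi>2)) f
         + contour_integral (linepath (Complex X' \<phi>2) (Complex X \<phi>2)) f"
proof -
  define P where "P = linepath (Complex X' \<phi>1) (Complex X \<phi>1) +++
    linepath (Complex X \<phi>1) (Complex X \<phi>2) +++ linepath (Complex X \<phi>2) (Complex X' \<phi>2) +++
    linepath (Complex X' \<phi>2) (Complex X' \<phi>1)"
  have seg: "closed_segment u v \<subseteq> S" if "u \<in> S" "v \<in> S" for u v
    using that assms(1) by (simp add: closed_segment_subset)
  have int: "f contour_integrable_on linepath u v" if "u \<in> S" "v \<in> S" for u v
    using seg[OF that] assms(2) holomorphic_on_imp_continuous_on continuous_on_subset
    by (blast intro: contour_integrable_continuous_linepath)
  have rev: "contour_integral (linepath u v) f = - contour_integral (linepath v u) f"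
    if "u \<in> S" "v \<in> S" for u v
    using seg[OF that] assms(2) holomorphic_on_imp_continuous_on continuous_on_subset
    by (blast intro: contour_integral_reverse_linepath)
  have "path_image P \<subseteq> S"
    unfolding P_def using seg assms by (auto simp: path_image_join)
  hence "(f has_contour_integral 0) P"
    by (intro Cauchy_theorem_convex_simple[OF assms(2,1)]) (auto simp: P_def)
  hence "0 = contour_integral P f" by (simp add: contour_integral_unique)
  also have "\<dots> = contour_integral (linepath (Complex X' \<phi>1) (Complex X \<phi>1)) f
         + contour_integral (linepath (Complex X \<phi>1) (Complex X \<phi>2)) f
         + contour_integral (linepath (Complex X \<phi>2) (Complex X' \<phi>2)) f
         + contour_integral (linepath (Complex X' \<phi>2) (Complex X' \<phi>1)) f"
    unfolding P_def using int assms by simp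
  finally show ?thesis
    using rev[of "Complex X \<phi>2" "Complex X' \<phi>2"] rev[of "Complex X' \<phi>2" "Complex X' \<phi>1"] assms
    by (simp add: diff_eq_eq add.commute)
qed

text \<open>The two truncations differ by the boundary of a rectangle to the left of w, and 1 / (s -
  w) is holomorphic on the half-plane Re s < Re w.\<close>

lemma truncated_loop_extend:
  assumes g: "valid_path g" "pathstart g = Complex R \<phi>1" "pathfinish g = Complex R \<phi>2"
    and X: "X' < X" "X < R" "X < Re w"
    and w: "w \<notin> path_image (truncated_loop \<phi>1 \<phi>2 R g X')"
  shows "w \<notin> path_image (truncated_loop \<phi>1 \<phi>2 R g X)"
    and "winding_number (truncated_loop \<phi>1 \<phi>2 R g X) w =
         winding_number (truncated_loop \<phi>1 \<phi>2 R g X') w"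
proof -
  show w': "w \<notin> path_image (truncated_loop \<phi>1 \<phi>2 R g X)"
    using w X unfolding truncated_loop_simps(3)[OF g]
    by (auto simp: closed_segment_horizontal closed_segment_vertical closed_segment_eq_real_ivl)
  define f where "f = (\<lambda>s. 1 / (s - w))"
  have hol: "f holomorphic_on (- {w})"
    unfolding f_def by (auto intro!: holomorphic_intros)
  define H where "H = {s. Re s < Re w}"
  have H: "convex H" "f holomorphic_on H"
    unfolding H_def by (auto simp: convex_halfspace_Re_lt intro!: holomorphic_on_subset[OF hol])
  have split: "contour_integral (linepath (Complex X' \<phi>) (Complex R \<phi>)) f =
      contour_integral (linepath (Complex X' \<phi>) (Complex X \<phi>)) f +
      contour_integral (linepath (Complex X \<phi>) (Complex R \<phi>)) f"
    if "\<phi> = \<phi>1 \<or> \<phi> = \<phi>2" for \<phi>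
  proof (rule contour_integral_split_linepath)
    have "closed_segment (Complex X' \<phi>) (Complex R \<phi>) \<subseteq> - {w}"
      using w that unfolding truncated_loop_simps(3)[OF g] by (auto simp: closed_segment_commute)
    thus "continuous_on (closed_segment (Complex X' \<phi>) (Complex R \<phi>)) f"
      by (intro holomorphic_on_imp_continuous_on holomorphic_on_subset[OF hol])
    show "Complex X \<phi> \<in> closed_segment (Complex X' \<phi>) (Complex R \<phi>)"
      using X by (simp add: closed_segment_horizontal closed_segment_eq_real_ivl)
  qed
  have rect: "contour_integral (linepath (Complex X' \<phi>1) (Complex X \<phi>1)) f
         + contour_integral (linepath (Complex X \<phi>1) (Complex X \<phi>2)) f
         = contour_integral (linepath (Complex X' \<phi>1) (Complex X' \<phi>2)) f
         + contour_integral (linepath (Complex X' \<phi>2) (Complex X \<phi>2)) f"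
    using X by (intro contour_integral_rectangle[OF H]) (auto simp: H_def)
  have "contour_integral (truncated_loop \<phi>1 \<phi>2 R g X) f =
        contour_integral (truncated_loop \<phi>1 \<phi>2 R g X') f"
    using rect w w'
    by (subst (1 2) contour_integral_truncated_loop[OF g _ hol]) (auto simp: split algebra_simps)
  thus "winding_number (truncated_loop \<phi>1 \<phi>2 R g X) w =
        winding_number (truncated_loop \<phi>1 \<phi>2 R g X') w"
    using w w' g by (simp add: winding_number_valid_path truncated_loop_simps f_def)
qed

text \<open>\<open>loop_winds\<close> speaks only of truncations far to the left; one of them
  carries the winding number over to every cut X left of R and of w.\<close>

lemma loop_winds_truncated:
  assumes g: "valid_path g" "pathstart g = Complex R \<phi>1" "pathfinish g = Complex R \<phi>2"
    and X: "X < R" "X < Re w" and w: "loop_winds \<phi>1 \<phi>2 R g w k"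
  shows "w \<notin> path_image (truncated_loop \<phi>1 \<phi>2 R g X)"
    and "winding_number (truncated_loop \<phi>1 \<phi>2 R g X) w = k"
proof -
  have "\<forall>\<^sub>F X' in at_bot. (w \<notin> path_image (truncated_loop \<phi>1 \<phi>2 R g X') \<and>
      winding_number (truncated_loop \<phi>1 \<phi>2 R g X') w = k) \<and> X' < X"
    using w unfolding loop_winds_def by (rule eventually_conj) (rule eventually_gt_at_bot)
  then obtain X' where X': "w \<notin> path_image (truncated_loop \<phi>1 \<phi>2 R g X')"
      "winding_number (truncated_loop \<phi>1 \<phi>2 R g X') w = k" "X' < X"
    using eventually_happens'[OF trivial_limit_at_bot_linorder] by blast
  show "w \<notin> path_image (truncated_loop \<phi>1 \<phi>2 R g X)"
    and "winding_number (truncated_loop \<phi>1 \<phi>2 R g X) w = k"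
    using truncated_loop_extend[OF g X'(3) X X'(1)] X'(2) by auto
qed

text \<open>A truncation with its cut left of w contains g and every point of the half-lines that
  could be w. Applied to the poles, this makes the kernel regular on the whole infinite
  contour.\<close>

lemma loop_winds_avoids:
  assumes g: "valid_path g" "pathstart g = Complex R \<phi>1" "pathfinish g = Complex R \<phi>2"
    and w: "loop_winds \<phi>1 \<phi>2 R g w k"
  shows "w \<notin> path_image g" and "Im w = \<phi>1 \<or> Im w = \<phi>2 \<Longrightarrow> Re w > R"
proof -
  have "\<forall>\<^sub>F X in at_bot. (w \<notin> path_image (truncated_loop \<phi>1 \<phi>2 R g X) \<and>
      winding_number (truncated_loop \<phi>1 \<phi>2 R g X) w = k) \<and> X < min R (Re w)"
    using w unfolding loop_winds_def by (rule eventually_conj) (rule eventually_gt_at_bot)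
  then obtain X where X: "w \<notin> path_image (truncated_loop \<phi>1 \<phi>2 R g X)" "X < R" "X < Re w"
    using eventually_happens'[OF trivial_limit_at_bot_linorder] min_less_iff_conj by blast
  show "w \<notin> path_image g" using X unfolding truncated_loop_simps(3)[OF g] by auto
  show "Re w > R" if "Im w = \<phi>1 \<or> Im w = \<phi>2"
    using X that unfolding truncated_loop_simps(3)[OF g]
    by (auto simp: closed_segment_horizontal closed_segment_eq_real_ivl)
qed

text \<open>The truncated loop stays in the convex half-plane Re s \<ge> X, and w lies outside
  it.\<close>

lemma winding_number_truncated_left:
  assumes g: "valid_path g" "pathstart g = Complex R \<phi>1" "pathfinish g = Complex R \<phi>2"
    and X: "X \<le> R" "\<And>s. s \<in> path_image g \<Longrightarrow> X \<le> Re s" and w: "Re w < X"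
  shows "w \<notin> path_image (truncated_loop \<phi>1 \<phi>2 R g X)"
    and "winding_number (truncated_loop \<phi>1 \<phi>2 R g X) w = 0"
proof -
  have sub: "path_image (truncated_loop \<phi>1 \<phi>2 R g X) \<subseteq> {s. Re s \<ge> X}"
    using X unfolding truncated_loop_simps(3)[OF g]
    by (auto simp: closed_segment_horizontal closed_segment_vertical closed_segment_eq_real_ivl)
  thus "w \<notin> path_image (truncated_loop \<phi>1 \<phi>2 R g X)" using w by auto
  show "winding_number (truncated_loop \<phi>1 \<phi>2 R g X) w = 0"
    using sub w truncated_loop_simps[OF g]
    by (intro winding_number_zero_outside[where s = "{s. Re s \<ge> X}"])
       (auto simp: convex_halfspace_Re_ge valid_path_imp_path)
qed

section \<open>Integrals along left half-lines\<close>

lemma exp_integral_left: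
  fixes c :: real
  assumes "c > 0"
  shows "(\<lambda>x. exp (c * x)) integrable_on {..X}" "integral {..X} (\<lambda>x. exp (c * x)) = exp (c * X) / c"
proof -
  have "(\<lambda>x. exp (-c * x)) absolutely_integrable_on {-X..}"
    using assms by (intro nonnegative_absolutely_integrable_1 integrable_on_exp_minus_to_infinity) auto
  moreover have "integral {-X..} (\<lambda>x. exp (-c * x)) = exp (c * X) / c"
    using has_integral_exp_minus_to_infinity[OF assms, of "-X"] by (simp add: integral_unique)
  ultimately have "(\<lambda>x. exp (-c * (-x))) absolutely_integrable_on {..X} \<and>
      integral {..X} (\<lambda>x. exp (-c * (-x))) = exp (c * X) / c"
    by (subst has_absolute_integral_reflect_real[where B = "{-X..}"]) auto
  thus "(\<lambda>x. exp (c * x)) integrable_on {..X}" "integral {..X} (\<lambda>x. exp (c * x)) = exp (c * X) / c"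
    using set_lebesgue_integral_eq_integral(1) by force+
qed

text \<open>Integrability over the unbounded half-line is not assumed: continuity and the
  exponential majorant provide it. This matters because \<open>integral\<close> takes the default
  value 0 otherwise.\<close>

lemma half_line_integral_bound:
  fixes h :: "real \<Rightarrow> complex"
  assumes "continuous_on {..R} h" "X \<le> R" "c > 0" "\<And>x. x \<le> X \<Longrightarrow> norm (h x) \<le> K * exp (c * x)"
  shows "integral {..R} h = integral {..X} h + integral {X..R} h"
    and "norm (integral {..X} h) \<le> K * exp (c * X) / c"
proof -
  have int: "(\<lambda>x. K * exp (c * x)) integrable_on {..X}"
    using exp_integral_left(1)[OF assms(3)] by (intro integrable_on_mult_right)
  have h: "h integrable_on {..X}"
  proof (rule measurable_bounded_by_integrable_imp_integrable[OF _ int])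
    show "h \<in> borel_measurable (lebesgue_on {..X})"
      using assms by (intro continuous_imp_measurable_on_sets_lebesgue)
                     (auto intro: continuous_on_subset)
  qed (use assms in auto)
  have "h integrable_on {X..R}"
    using assms by (intro integrable_continuous_real) (auto intro: continuous_on_subset)
  moreover have "{..R} = {..X} \<union> {X..R}" "{..X} \<inter> {X..R} = {X}" using assms(2) by auto
  ultimately show "integral {..R} h = integral {..X} h + integral {X..R} h"
    using h by (simp add: integral_Un)
  have "norm (integral {..X} h) \<le> integral {..X} (\<lambda>x. K * exp (c * x))"
    using assms by (intro integral_norm_bound_integral h int) auto
  also have "\<dots> = K * exp (c * X) / c"
    using exp_integral_left(2)[OF assms(3)] by simp
  finally show "norm (integral {..X} h) \<le> K * exp (c * X) / c" .
qed

section \<open>Residues\<close>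

text \<open>The residue theorem is applied in a ball and needs finitely many singular points there;
  the modulus of A + c s limits the integer -k that it equals at a pole.\<close>

lemma finite_Gamma_poles:
  assumes "c \<noteq> (0::real)"
  shows "finite {s. A + of_real c * s \<in> \<int>\<^sub>\<le>\<^sub>0 \<and> norm (s :: complex) < \<rho>}"
proof (rule finite_subset)
  define N where "N = nat \<lceil>norm A + \<bar>c\<bar> * \<rho>\<rceil>"
  show "finite ((\<lambda>k. (- of_nat k - A) / of_real c) ` {..N})" by simp
  show "{s. A + of_real c * s \<in> \<int>\<^sub>\<le>\<^sub>0 \<and> norm s < \<rho>} \<subseteq> (\<lambda>k. (- of_nat k - A) / of_real c) ` {..N}"
  proof safe
    fix s assume s: "A + of_real c * s \<in> \<int>\<^sub>\<le>\<^sub>0" "norm s < \<rho>"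
    then obtain k where k: "A + of_real c * s = - of_nat k" by (elim nonpos_Ints_cases')
    have "real k = norm (A + of_real c * s)" unfolding k by simp
    also have "\<dots> \<le> norm A + \<bar>c\<bar> * norm s"
      by (rule norm_triangle_le) (simp add: norm_mult)
    also have "\<dots> \<le> norm A + \<bar>c\<bar> * \<rho>" using s by (intro add_mono mult_left_mono) auto
    finally have "k \<in> {..N}" unfolding N_def by simp linarith
    moreover have "s = (- of_nat k - A) / of_real c"
      using assms unfolding k[symmetric] by simp
    ultimately show "s \<in> (\<lambda>k. (- of_nat k - A) / of_real c) ` {..N}" by blast
  qed
qed

text \<open>T may be a proper subset because a neighbourhood of one pole is obtained by excluding
  all the others.\<close>

lemma open_avoid_nonpos_Ints:
  assumes "T \<subseteq> \<int>\<^sub>\<le>\<^sub>0"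
  shows "open {s :: complex. A + c * s \<notin> T}"
proof -
  have "closed T" using assms by (intro closed_subset_Ints) (auto simp: nonpos_Ints_def)
  hence "open ((\<lambda>s. A + c * s) -` (- T))"
    by (intro open_vimage continuous_intros) auto
  thus ?thesis by (simp add: vimage_def)
qed

lemma Gamma_argument_eq_iff:
  assumes "\<beta> \<noteq> (0 :: complex)"
  shows "B + \<beta> * s = - k \<longleftrightarrow> s = - ((B + k) / \<beta>)"
proof -
  have "s = - ((B + k) / \<beta>) \<longleftrightarrow> \<beta> * s = - (B + k)"
    using assms by (metis divide_minus_left nonzero_mult_div_cancel_left nonzero_eq_divide_eq mult.commute)
  thus ?thesis by (auto simp: algebra_simps eq_neg_iff_add_eq_0)
qed

section \<open>Exponents, poles and residues of the kernel\<close>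

locale fox_parameters =
  fixes m n p q :: nat
    and a b :: "nat \<Rightarrow> complex" and \<alpha> \<beta> :: "nat \<Rightarrow> real"
  assumes m_le_q: "m \<le> q" and n_le_p: "n \<le> p"
    and \<alpha>_pos: "i \<in> {1..p} \<Longrightarrow> \<alpha> i > 0"
    and \<beta>_pos: "j \<in> {1..q} \<Longrightarrow> \<beta> j > 0"
    and left_right_disjoint: "i \<in> {1..n} \<Longrightarrow> j \<in> {1..m} \<Longrightarrow>
           of_real (\<beta> j) * (a i - 1 - of_nat k) \<noteq> of_real (\<alpha> i) * (b j + of_nat l)"
    and left_simple: "i \<in> {1..m} \<Longrightarrow> j \<in> {1..m} \<Longrightarrow> i \<noteq> j \<Longrightarrow>
           of_real (\<beta> j) * (b i + of_nat k) \<noteq> of_real (\<beta> i) * (b j + of_nat l)"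
    and Delta_nonneg: "fox_Delta p q \<alpha> \<beta> \<ge> 0"
begin

abbreviation "\<H> \<equiv> fox_kernel m n p q a \<alpha> b \<beta>"
abbreviation "index_set \<equiv> {1..m} \<times> (UNIV :: nat set)"

definition rcoeff :: "nat \<times> nat \<Rightarrow> complex" where
  "rcoeff = (\<lambda>(j, l). fox_coeff m n p q a \<alpha> b \<beta> j l)"

text \<open>The left poles are the numbers \<open>- expo i\<close>; the factor z^(-s) of the
  integrand turns such a pole into a power with exponent \<open>expo i\<close>.\<close>

definition expo :: "nat \<times> nat \<Rightarrow> complex" where
  "expo = (\<lambda>(j, l). (b j + of_nat l) / of_real (\<beta> j))"

lemma \<alpha>_pos': "i \<in> {1..n} \<Longrightarrow> \<alpha> i > 0" and \<beta>_pos': "j \<in> {1..m} \<Longrightarrow> \<beta> j > 0"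
  using \<alpha>_pos \<beta>_pos n_le_p m_le_q by auto

lemma left_poles_eq: "left_poles m b \<beta> = (\<lambda>i. - expo i) ` index_set"
proof -
  have "b j + of_real (\<beta> j) * s = - of_nat l \<longleftrightarrow> s = - expo (j, l)" if "j \<in> {1..m}" for j l s
    using \<beta>_pos'[OF that] by (simp add: expo_def Gamma_argument_eq_iff)
  hence "b j + of_real (\<beta> j) * s \<in> \<int>\<^sub>\<le>\<^sub>0 \<longleftrightarrow> (\<exists>l. s = - expo (j, l))" if "j \<in> {1..m}" for j s
    using that by (metis minus_of_nat_in_nonpos_Ints nonpos_Ints_cases')
  thus ?thesis unfolding left_poles_def by auto
qed

text \<open>Distinct pairs (j, l) never share a pole, so the sum over poles in the residue theorem
  can be reindexed by pairs. For different j this is \<open>left_simple\<close>; for equal j it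
  follows from \<beta> j \<noteq> 0.\<close>

lemma inj_on_expo: "inj_on expo index_set"
proof (rule inj_onI)
  fix i i' assume i: "i \<in> index_set" "i' \<in> index_set" and eq': "expo i = expo i'"
  obtain j l j' l' where ii': "i = (j, l)" "i' = (j', l')" by fastforce
  have j: "j \<in> {1..m}" "j' \<in> {1..m}" and eq: "expo (j, l) = expo (j', l')"
    using i eq' by (auto simp: ii')
  have "of_real (\<beta> j') * (b j + of_nat l) = of_real (\<beta> j) * (b j' + of_nat l')"
    using eq \<beta>_pos'[OF j(1)] \<beta>_pos'[OF j(2)] unfolding expo_def by (auto simp: field_simps)
  moreover from this have "j = j'" using left_simple[OF j] by blast
  ultimately show "i = i'" using \<beta>_pos'[OF j(1)] by (auto simp: ii')
qed

lemma finite_expo_le: "finite {i \<in> index_set. Re (expo i) \<le> M}"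
proof -
  \<comment> \<open>A sum in place of a maximum: the summands are natural numbers, so N dominates
    each of them.\<close>
  define N where "N = (\<Sum>j=1..m. nat \<lceil>M * \<beta> j - Re (b j)\<rceil>)"
  have "{i \<in> index_set. Re (expo i) \<le> M} \<subseteq> {1..m} \<times> {..N}"
  proof
    fix i assume i: "i \<in> {i \<in> index_set. Re (expo i) \<le> M}"
    then obtain j l where jl: "i = (j, l)" and j: "j \<in> {1..m}" by auto
    have le: "Re (expo (j, l)) \<le> M" using i jl by simp
    have "real l \<le> M * \<beta> j - Re (b j)"
      using le \<beta>_pos'[OF j] by (simp add: expo_def field_simps)
    hence "l \<le> nat \<lceil>M * \<beta> j - Re (b j)\<rceil>" by linarith
    also have "\<dots> \<le> N" unfolding N_def by (rule member_le_sum[OF j]) auto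
    finally show "i \<in> {1..m} \<times> {..N}" using j jl by simp
  qed
  thus ?thesis by (rule finite_subset) auto
qed

lemma finite_expo_less: "finite {i \<in> index_set. Re (expo i) < M}"
  by (rule finite_subset[OF _ finite_expo_le[of M]]) auto

lemma finite_poles: "finite ((left_poles m b \<beta> \<union> right_poles n a \<alpha>) \<inter> ball 0 \<rho>)"
proof -
  have "(left_poles m b \<beta> \<union> right_poles n a \<alpha>) \<inter> ball 0 \<rho> =
    (\<Union>j\<in>{1..m}. {s. b j + of_real (\<beta> j) * s \<in> \<int>\<^sub>\<le>\<^sub>0 \<and> norm s < \<rho>}) \<union>
    (\<Union>i\<in>{1..n}. {s. (1 - a i) + of_real (- \<alpha> i) * s \<in> \<int>\<^sub>\<le>\<^sub>0 \<and> norm s < \<rho>})"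
    unfolding left_poles_def right_poles_def by auto
  moreover have "\<beta> j \<noteq> 0" if "j \<in> {1..m}" for j using \<beta>_pos'[OF that] by simp
  moreover have "- \<alpha> i \<noteq> 0" if "i \<in> {1..n}" for i using \<alpha>_pos'[OF that] by simp
  ultimately show ?thesis
    by (simp only:) (intro finite_UnI finite_UN_I finite_atLeastAtMost finite_Gamma_poles; blast)
qed

lemma open_Compl_poles: "open (- (left_poles m b \<beta> \<union> right_poles n a \<alpha>))"
proof -
  have "- (left_poles m b \<beta> \<union> right_poles n a \<alpha>) =
    (\<Inter>j\<in>{1..m}. {s. b j + of_real (\<beta> j) * s \<notin> \<int>\<^sub>\<le>\<^sub>0}) \<inter>
    (\<Inter>i\<in>{1..n}. {s. (1 - a i) + (- of_real (\<alpha> i)) * s \<notin> \<int>\<^sub>\<le>\<^sub>0})"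
    unfolding left_poles_def right_poles_def by auto
  thus ?thesis by (simp only:) (intro open_Int open_INT ballI open_avoid_nonpos_Ints; simp)
qed

lemma holomorphic_fox_kernel:
  assumes "S \<inter> (left_poles m b \<beta> \<union> right_poles n a \<alpha>) = {}"
  shows "\<H> holomorphic_on S"
proof -
  have "b j + of_real (\<beta> j) * s \<notin> \<int>\<^sub>\<le>\<^sub>0" if "s \<in> S" "j \<in> {1..m}" for s j
    using assms that unfolding left_poles_def by blast
  moreover have "1 - a i - of_real (\<alpha> i) * s \<notin> \<int>\<^sub>\<le>\<^sub>0" if "s \<in> S" "i \<in> {1..n}" for s i
    using assms that unfolding right_poles_def by blast
  ultimately show ?thesis
    unfolding fox_kernel_def by (intro holomorphic_intros) blast+
qed

text \<open>Near w = \<open>- expo i\<close> only the j-th Gamma factor is singular. With u = b j +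
  \<beta> j s one has s - w = (u + l) / \<beta> j, so the residue (-1)^l / l! of
  \<open>Gamma\<close> at -l acquires the factor 1 / \<beta> j.\<close>

lemma residue_fox_kernel:
  assumes h: "h holomorphic_on UNIV" and i: "i \<in> index_set"
  shows "residue (\<lambda>s. \<H> s * h s) (- expo i) = rcoeff i * h (- expo i)"
proof -
  obtain j l where i_eq: "i = (j, l)" and j: "j \<in> {1..m}" using i by auto
  define w where "w = - expo i"
  have \<beta>j: "\<beta> j > 0" using \<beta>_pos'[OF j] .
  \<comment> \<open>S excludes every pole except w: for the j-th factor the value -l is allowed
    again, for the other Gamma factors nothing is.\<close>
  define S where "S = {s. b j + of_real (\<beta> j) * s \<notin> \<int>\<^sub>\<le>\<^sub>0 - {- of_nat l}} \<inter>
    (\<Inter>i\<in>{1..m}-{j}. {s. b i + of_real (\<beta> i) * s \<notin> \<int>\<^sub>\<le>\<^sub>0}) \<inter>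
    (\<Inter>i\<in>{1..n}. {s. (1 - a i) + (- of_real (\<alpha> i)) * s \<notin> \<int>\<^sub>\<le>\<^sub>0})"
  define r where "r = (\<lambda>s. (\<Prod>i\<in>{1..m}-{j}. Gamma (b i + of_real (\<beta> i) * s)) *
     (\<Prod>i=1..n. Gamma (1 - a i - of_real (\<alpha> i) * s)) *
     (\<Prod>i=n+1..p. rGamma (a i + of_real (\<alpha> i) * s)) *
     (\<Prod>j=m+1..q. rGamma (1 - b j - of_real (\<beta> j) * s)) * h s)"
  have "open S" unfolding S_def
    by (intro open_Int open_INT ballI open_avoid_nonpos_Ints) auto
  have bj: "b j + of_real (\<beta> j) * s = - of_nat l \<longleftrightarrow> s = w" for s
    using \<beta>j by (simp add: w_def i_eq expo_def Gamma_argument_eq_iff)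
  \<comment> \<open>The two non-coincidence hypotheses on the parameters enter here: they keep the
    arguments of the other Gamma factors off the poles.\<close>
  have w: "w \<in> S"
  proof -
    have "b i + of_real (\<beta> i) * w \<notin> \<int>\<^sub>\<le>\<^sub>0" if i: "i \<in> {1..m} - {j}" for i
    proof
      assume "b i + of_real (\<beta> i) * w \<in> \<int>\<^sub>\<le>\<^sub>0"
      then obtain k where "b i + of_real (\<beta> i) * w = - of_nat k" by (elim nonpos_Ints_cases')
      hence "b i + of_nat k = - of_real (\<beta> i) * w" by (simp add: eq_neg_iff_add_eq_0 ac_simps)
      hence "of_real (\<beta> j) * (b i + of_nat k) = of_real (\<beta> i) * (b j + of_nat l)"
        using \<beta>j by (simp add: w_def i_eq expo_def)
      thus False using left_simple[of i j k l] i j by auto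
    qed
    moreover have "(1 - a i) + (- of_real (\<alpha> i)) * w \<notin> \<int>\<^sub>\<le>\<^sub>0" if i: "i \<in> {1..n}" for i
    proof
      assume "(1 - a i) + (- of_real (\<alpha> i)) * w \<in> \<int>\<^sub>\<le>\<^sub>0"
      then obtain k where "(1 - a i) + (- of_real (\<alpha> i)) * w = - of_nat k" by (elim nonpos_Ints_cases')
      hence "a i - 1 - of_nat k = - of_real (\<alpha> i) * w" by (simp add: algebra_simps)
      hence "of_real (\<beta> j) * (a i - 1 - of_nat k) = of_real (\<alpha> i) * (b j + of_nat l)"
        using \<beta>j by (simp add: w_def i_eq expo_def)
      thus False using left_right_disjoint[OF i j] by blast
    qed
    ultimately show ?thesis using bj[of w] unfolding S_def by auto
  qed
  have "(\<lambda>s. \<H> s * h s) holomorphic_on (S - {w})"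
  proof (intro holomorphic_intros holomorphic_fox_kernel)
    have "s \<notin> left_poles m b \<beta> \<union> right_poles n a \<alpha>" if s: "s \<in> S" "s \<noteq> w" for s
      using s bj[of s] unfolding S_def left_poles_def right_poles_def by auto
    thus "(S - {w}) \<inter> (left_poles m b \<beta> \<union> right_poles n a \<alpha>) = {}" by blast
  qed (use h in \<open>auto intro: holomorphic_on_subset\<close>)
  moreover have "(\<lambda>s. \<H> s * h s * (s - w)) \<midarrow>w\<rightarrow> ((-1) ^ l / fact l) / of_real (\<beta> j) * r w"
  proof -
    have "r holomorphic_on S" unfolding r_def
      by (intro holomorphic_intros holomorphic_on_subset[OF h]) (auto simp: S_def)
    hence "isCont r w" using w \<open>open S\<close>
      by (metis continuous_on_eq_continuous_at holomorphic_on_imp_continuous_on)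
    hence r: "r \<midarrow>w\<rightarrow> r w" by (simp add: isCont_def)
    have lim: "filterlim (\<lambda>s. b j + of_real (\<beta> j) * s) (at (- of_nat l)) (at w)"
    proof (rule filterlim_atI)
      show "(\<lambda>s. b j + of_real (\<beta> j) * s) \<midarrow>w\<rightarrow> - of_nat l"
        using bj[of w] by (auto intro!: tendsto_eq_intros)
      show "\<forall>\<^sub>F s in at w. b j + of_real (\<beta> j) * s \<noteq> - of_nat l"
        using bj by (simp add: eventually_at_filter)
    qed
    have "(\<lambda>s. Gamma (b j + of_real (\<beta> j) * s) * (b j + of_real (\<beta> j) * s + of_nat l) / of_real (\<beta> j) * r s)
        \<midarrow>w\<rightarrow> ((-1) ^ l / fact l) / of_real (\<beta> j) * r w"
      using filterlim_compose[OF Gamma_residues lim] \<beta>j by (intro tendsto_intros r) auto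
    moreover have "Gamma (b j + of_real (\<beta> j) * s) * (b j + of_real (\<beta> j) * s + of_nat l) / of_real (\<beta> j) * r s =
        \<H> s * h s * (s - w)" for s
    proof -
      have "b j + of_real (\<beta> j) * s + of_nat l = of_real (\<beta> j) * (s - w)"
        using \<beta>j by (simp add: w_def i_eq expo_def field_simps)
      hence "Gamma (b j + of_real (\<beta> j) * s) * (b j + of_real (\<beta> j) * s + of_nat l) / of_real (\<beta> j) * r s
          = Gamma (b j + of_real (\<beta> j) * s) * r s * (s - w)"
        using \<beta>j by simp
      also have "Gamma (b j + of_real (\<beta> j) * s) * r s = \<H> s * h s"
        unfolding r_def fox_kernel_def
        using prod.remove[of "{1..m}" j "\<lambda>j. Gamma (b j + of_real (\<beta> j) * s)"] j
        by (simp add: mult_ac)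
      finally show ?thesis .
    qed
    ultimately show ?thesis by simp
  qed
  ultimately have "residue (\<lambda>s. \<H> s * h s) w = ((-1) ^ l / fact l) / of_real (\<beta> j) * r w"
    using \<open>open S\<close> w by (intro residue_simple'[where s = S])
  also have "\<dots> = rcoeff i * h w"
  proof -
    have "of_real c * w = - ((b j + of_nat l) * of_real (c / \<beta> j))" for c
      by (simp add: w_def i_eq expo_def)
    thus ?thesis unfolding r_def i_eq by (simp add: rcoeff_def fox_coeff_def)
  qed
  finally show ?thesis unfolding w_def .
qed

end

section \<open>The loop and its residue sum\<close>

locale fox_integral = fox_parameters +
  fixes \<phi>1 \<phi>2 R :: real and g :: "real \<Rightarrow> complex" and lg :: "complex \<Rightarrow> complex"
  assumes loop: "fox_loop m n a \<alpha> b \<beta> \<phi>1 \<phi>2 R g" and lg: "log_branch lg"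
begin

lemma loop_path: "valid_path g" "pathstart g = Complex R \<phi>1" "pathfinish g = Complex R \<phi>2"
  and \<phi>_less: "\<phi>1 < \<phi>2"
  and winds_left: "w \<in> left_poles m b \<beta> \<Longrightarrow> loop_winds \<phi>1 \<phi>2 R g w 1"
  and winds_right: "w \<in> right_poles n a \<alpha> \<Longrightarrow> loop_winds \<phi>1 \<phi>2 R g w 0"
  using loop by (auto simp: fox_loop_def)

abbreviation poles :: "complex set" where
  "poles \<equiv> left_poles m b \<beta> \<union> right_poles n a \<alpha>"

abbreviation integrand :: "complex \<Rightarrow> complex \<Rightarrow> complex" where
  "integrand z s \<equiv> \<H> s * branch_pow lg z (- s)"

abbreviation closed_loop :: "real \<Rightarrow> real \<Rightarrow> complex" where
  "closed_loop \<equiv> truncated_loop \<phi>1 \<phi>2 R g"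

lemma poles_avoid:
  assumes "w \<in> poles"
  shows "w \<notin> path_image g" and "Im w = \<phi>1 \<or> Im w = \<phi>2 \<Longrightarrow> Re w > R"
  using assms loop_winds_avoids[OF loop_path] winds_left winds_right by blast+

lemma holomorphic_branch_pow: "(\<lambda>s. branch_pow lg z (- s)) holomorphic_on S"
  unfolding branch_pow_def by (intro holomorphic_intros)

lemma holomorphic_integrand: "S \<inter> poles = {} \<Longrightarrow> integrand z holomorphic_on S"
  by (intro holomorphic_intros holomorphic_fox_kernel holomorphic_branch_pow)

text \<open>Right poles form progressions towards +\<infinity>, so their real parts are bounded
  below. To the left of X0 there are only left poles and the two half-lines.\<close>

lemma left_bounds:
  obtains X0 where "X0 < R" "\<And>s. s \<in> path_image g \<Longrightarrow> X0 < Re s"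
    "\<And>w. w \<in> right_poles n a \<alpha> \<Longrightarrow> X0 < Re w"
proof -
  have "compact (Re ` path_image g)"
    using valid_path_imp_path[OF loop_path(1)] compact_path_image
    by (intro compact_continuous_image continuous_intros) auto
  then obtain c where c: "\<And>s. s \<in> path_image g \<Longrightarrow> c < Re s"
    by (metis bounded_real compact_imp_bounded image_eqI abs_le_iff minus_le_iff
          less_le_trans lt_ex)
  define d where "d = (\<Sum>i=1..n. \<bar>(1 - Re (a i)) / \<alpha> i\<bar>)"
  have d: "Re w \<ge> -d" if w: "w \<in> right_poles n a \<alpha>" for w
  proof -
    obtain i k where i: "i \<in> {1..n}" "1 - a i - of_real (\<alpha> i) * w = - of_nat k"
      using w unfolding right_poles_def by (auto elim!: nonpos_Ints_cases')
    have "1 - Re (a i) - \<alpha> i * Re w = - real k" using arg_cong[OF i(2), of Re] by simp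
    hence "Re w \<ge> (1 - Re (a i)) / \<alpha> i" using \<alpha>_pos'[OF i(1)] by (simp add: field_simps)
    moreover have "\<bar>(1 - Re (a i)) / \<alpha> i\<bar> \<le> d"
      unfolding d_def by (rule member_le_sum[OF i(1)]) auto
    ultimately show ?thesis by linarith
  qed
  show thesis
    by (rule that[of "min R (min c (-d)) - 1"]) (use c d in force)+
qed

text \<open>The inequality is strict since \<open>Re (expo i) < M\<close> says that the pole
  \<open>- expo i\<close> lies to the right of the cut at abscissa -M.\<close>

definition residue_sum :: "real \<Rightarrow> complex \<Rightarrow> complex" where
  "residue_sum M z = (\<Sum>i | i \<in> index_set \<and> Re (expo i) < M. rcoeff i * branch_pow lg z (expo i))"

text \<open>Winding numbers select the terms: 1 at left poles to the right of the cut, 0 at right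
  poles there by the loop condition, and 0 at all poles beyond the cut by convexity.\<close>

lemma contour_integral_closed_loop:
  assumes X: "X < R" "\<And>s. s \<in> path_image g \<Longrightarrow> X < Re s" and off: "\<And>w. w \<in> poles \<Longrightarrow> Re w \<noteq> X"
  shows "path_image (closed_loop X) \<inter> poles = {}"
    and "contour_integral (closed_loop X) (integrand z) =
      2 * of_real pi * \<i> * residue_sum (- X) z"
proof -
  define F where "F = {i \<in> index_set. Re (expo i) < - X}"
  have wn: "w \<notin> path_image (closed_loop X)"
      "winding_number (closed_loop X) w = (if w \<in> left_poles m b \<beta> \<and> Re w > X then 1 else 0)"
    if w: "w \<in> poles" for w
  proof -
    have "w \<notin> path_image (closed_loop X) \<and>
      winding_number (closed_loop X) w = (if w \<in> left_poles m b \<beta> \<and> Re w > X then 1 else 0)"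
    proof (cases "Re w > X")
      case True
      consider "w \<in> left_poles m b \<beta>" | "w \<notin> left_poles m b \<beta>" "w \<in> right_poles n a \<alpha>" using w by blast
      thus ?thesis
        by cases (use True loop_winds_truncated[OF loop_path X(1)] winds_left winds_right in \<open>metis\<close>)+
    next
      case False
      hence "Re w < X" using off[OF w] by linarith
      thus ?thesis using winding_number_truncated_left[OF loop_path less_imp_le[OF X(1)]] X(2)
        by (simp add: less_imp_le)
    qed
    thus "w \<notin> path_image (closed_loop X)"
      "winding_number (closed_loop X) w = (if w \<in> left_poles m b \<beta> \<and> Re w > X then 1 else 0)" by auto
  qed
  show disj: "path_image (closed_loop X) \<inter> poles = {}" using wn(1) by blast
  have loopX: "valid_path (closed_loop X)" "pathfinish (closed_loop X) = pathstart (closed_loop X)"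
    using truncated_loop_simps[OF loop_path] by auto
  have "finite F" unfolding F_def by (rule finite_expo_less)
  hence "bounded (path_image (closed_loop X) \<union> (\<lambda>i. - expo i) ` F)"
    using loopX by (simp add: bounded_path_image valid_path_imp_path finite_imp_bounded)
  then obtain \<rho> where \<rho>: "path_image (closed_loop X) \<subseteq> ball 0 \<rho>" "(\<lambda>i. - expo i) ` F \<subseteq> ball 0 \<rho>"
    by (meson bounded_subset_ballD Un_subset_iff)
  \<comment> \<open>There may be infinitely many poles; the ball contains the loop and all enclosed
    poles but only finitely many others.\<close>
  have "contour_integral (closed_loop X) (integrand z) =
      2 * pi * \<i> * (\<Sum>w\<in>poles \<inter> ball 0 \<rho>. winding_number (closed_loop X) w * residue (integrand z) w)"
  proof (rule Residue_theorem[where S = "ball 0 \<rho>"])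
    show "integrand z holomorphic_on ball 0 \<rho> - poles \<inter> ball 0 \<rho>"
      by (rule holomorphic_integrand) auto
    show "path_image (closed_loop X) \<subseteq> ball 0 \<rho> - poles \<inter> ball 0 \<rho>" using \<rho> disj by auto
    show "\<forall>w. w \<notin> ball 0 \<rho> \<longrightarrow> winding_number (closed_loop X) w = 0"
      using \<rho>(1) loopX valid_path_imp_path
      by (intro allI impI winding_number_zero_outside[where s = "ball 0 \<rho>"]) auto
  qed (use loopX finite_poles in auto)
  also have "(\<Sum>w\<in>poles \<inter> ball 0 \<rho>. winding_number (closed_loop X) w * residue (integrand z) w) =
      (\<Sum>w\<in>(\<lambda>i. - expo i) ` F. residue (integrand z) w)"
  proof (rule sum.mono_neutral_cong_right)
    have F: "w \<in> (\<lambda>i. - expo i) ` F \<longleftrightarrow> w \<in> left_poles m b \<beta> \<and> Re w > X" for w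
      unfolding left_poles_eq F_def image_iff by (auto simp: less_minus_iff[of X]; blast)
    show "finite (poles \<inter> ball 0 \<rho>)" by (rule finite_poles)
    show "(\<lambda>i. - expo i) ` F \<subseteq> poles \<inter> ball 0 \<rho>"
      using \<rho>(2) F by blast
    show "\<forall>w\<in>poles \<inter> ball 0 \<rho> - (\<lambda>i. - expo i) ` F. winding_number (closed_loop X) w * residue (integrand z) w = 0"
      by (intro ballI, subst wn(2)) (auto simp only: F Diff_iff Int_iff if_False mult_zero_left)
    show "winding_number (closed_loop X) w * residue (integrand z) w = residue (integrand z) w"
      if "w \<in> (\<lambda>i. - expo i) ` F" for w
      using wn(2)[of w] that unfolding F by simp
  qed
  also have "\<dots> = (\<Sum>i\<in>F. residue (integrand z) (- expo i))"
  proof -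
    have "inj_on (\<lambda>i. - expo i) F"
      by (rule inj_onI) (use inj_on_expo in \<open>auto simp only: F_def neg_equal_iff_equal dest: inj_onD\<close>)
    thus ?thesis by (simp only: sum.reindex o_def)
  qed
  also have "\<dots> = (\<Sum>i\<in>F. rcoeff i * branch_pow lg z (expo i))"
    by (intro sum.cong refl, subst residue_fox_kernel[OF holomorphic_branch_pow]) (auto simp: F_def)
  finally show "contour_integral (closed_loop X) (integrand z) =
      2 * of_real pi * \<i> * residue_sum (- X) z"
    by (simp add: F_def residue_sum_def)
qed

end

section \<open>Expansion at zero\<close>

lemma filterlim_norm_at_right_0: "filterlim norm (at_right 0) (at (0 :: complex))"
  unfolding filterlim_at by (auto simp: eventually_at_filter intro!: tendsto_eq_intros)

text \<open>Complex values allow direct comparison with H and with the powers of z in the Landau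
  classes; \<open>norm_smallo_iff\<close> returns to the real form.\<close>

abbreviation norm_powr :: "real \<Rightarrow> complex \<Rightarrow> complex" where
  "norm_powr u \<equiv> \<lambda>z. of_real (norm z powr u)"

lemma norm_powr_smallo:
  assumes "u < v"
  shows "norm_powr v \<in> o[at 0](norm_powr u)"
proof -
  have "(\<lambda>x. x powr v) \<in> o[at_right 0](\<lambda>x :: real. x powr u)"
    using assms by real_asymp
  from landau_o.small.compose[OF this filterlim_norm_at_right_0] show ?thesis
    by (simp only: landau_o.small.of_real_iff)
qed

lemma norm_powr_bigo:
  assumes "u \<le> v"
  shows "norm_powr v \<in> O[at 0](norm_powr u)"
proof (cases "u = v")
  case False
  thus ?thesis using assms norm_powr_smallo[of u v] by (auto intro: landau_o.small_imp_big)
qed simp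

lemma norm_smallo_iff:
  "(\<lambda>z. norm (f z)) \<in> o[at 0](\<lambda>z. norm z powr u) \<longleftrightarrow> f \<in> o[at 0](norm_powr u)"
  by (subst landau_o.small.norm_iff[symmetric]) simp

section \<open>Powers of z and the truncation error\<close>

context fox_integral
begin

definition arg_bound :: real where
  "arg_bound = (SOME A. \<forall>z. z \<noteq> 0 \<longrightarrow> \<bar>Im (lg z)\<bar> \<le> A)"

lemma Im_lg_le: "z \<noteq> 0 \<Longrightarrow> \<bar>Im (lg z)\<bar> \<le> arg_bound"
proof -
  have "\<exists>A. \<forall>z. z \<noteq> 0 \<longrightarrow> \<bar>Im (lg z)\<bar> \<le> A"
    using lg unfolding log_branch_def by blast
  from someI_ex[OF this] show "z \<noteq> 0 \<Longrightarrow> \<bar>Im (lg z)\<bar> \<le> arg_bound"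
    by (simp add: arg_bound_def)
qed

lemma arg_bound_nonneg: "arg_bound \<ge> 0"
  using Im_lg_le[of 1] by simp

lemma norm_branch_pow:
  assumes "z \<noteq> 0"
  shows "norm (branch_pow lg z c) = exp (- (Im c * Im (lg z))) * norm z powr Re c"
proof -
  have "exp (lg z) = z" using lg assms unfolding log_branch_def by blast
  hence "Re (lg z) = ln (norm z)" by (metis ln_exp norm_exp_eq_Re)
  thus ?thesis using assms by (simp add: branch_pow_def powr_def flip: exp_add)
qed

text \<open>A bounded argument keeps exp (- Im c * Im (lg z)) bounded and away from 0, so z^c has
  the exact order |z|^(Re c). The lower bound serves to turn errors in powers of |z| into errors in
  z^((b j + 1) / \<beta> j).\<close>

lemma norm_branch_pow_le:
    "z \<noteq> 0 \<Longrightarrow> norm (branch_pow lg z c) \<le> exp (arg_bound * \<bar>Im c\<bar>) * norm z powr Re c" (is "_ \<Longrightarrow> ?le")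
  and norm_branch_pow_ge:
    "z \<noteq> 0 \<Longrightarrow> norm (branch_pow lg z c) \<ge> exp (- (arg_bound * \<bar>Im c\<bar>)) * norm z powr Re c" (is "_ \<Longrightarrow> ?ge")
proof -
  assume z: "z \<noteq> 0"
  have "\<bar>Im c * Im (lg z)\<bar> \<le> arg_bound * \<bar>Im c\<bar>"
    using mult_left_mono[OF Im_lg_le[OF z], of "\<bar>Im c\<bar>"] by (simp add: abs_mult mult.commute)
  thus ?le ?ge
    unfolding norm_branch_pow[OF z] by (auto simp: abs_le_iff intro!: mult_right_mono)
qed

text \<open>The |sinh| bound depends only on the height of the half-line. It vanishes only at the
  common height of the poles \<open>- expo (j, l)\<close>, and there the half-line would meet them
  for large l.\<close>

lemma half_lines_sin_bound:
  assumes j: "j \<in> {1..m}"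
  shows "\<exists>\<epsilon>>0. \<forall>s\<in>{s. Im s = \<phi>1 \<or> Im s = \<phi>2}. norm (sin (of_real pi * (b j + of_real (\<beta> j) * s))) \<ge> \<epsilon>"
proof -
  define y where "y = (\<lambda>\<phi>. pi * (Im (b j) + \<beta> j * \<phi>))"
  define \<epsilon> where "\<epsilon> = (\<lambda>\<phi>. \<bar>exp (y \<phi>) - exp (- y \<phi>)\<bar> / 2)"
  have \<beta>j: "\<beta> j > 0" using \<beta>_pos'[OF j] .
  have pos: "\<epsilon> \<phi> > 0" if \<phi>: "\<phi> = \<phi>1 \<or> \<phi> = \<phi>2" for \<phi>
  proof -
    have "Im (b j) + \<beta> j * \<phi> \<noteq> 0"
    proof
      assume eq: "Im (b j) + \<beta> j * \<phi> = 0"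
      \<comment> \<open>For this l the pole \<open>- expo (j, l)\<close> has real part at most
        R.\<close>
      obtain l :: nat where l: "real l \<ge> - \<beta> j * R - Re (b j)" using real_arch_simple by blast
      have "- expo (j, l) \<in> poles" using j by (simp add: left_poles_eq)
      moreover have "Im (- expo (j, l)) = \<phi>" using eq \<beta>j by (simp add: expo_def field_simps)
      ultimately have "Re (- expo (j, l)) > R" using poles_avoid(2) \<phi> by metis
      thus False using l \<beta>j by (simp add: expo_def field_simps)
    qed
    hence "y \<phi> \<noteq> 0" by (simp add: y_def)
    thus ?thesis by (simp add: \<epsilon>_def)
  qed
  have bound: "norm (sin (of_real pi * (b j + of_real (\<beta> j) * s))) \<ge> \<epsilon> (Im s)" for s
    using norm_sin_ge[of "of_real pi * (b j + of_real (\<beta> j) * s)"] by (simp add: \<epsilon>_def y_def)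
  show ?thesis
    by (rule exI[of _ "min (\<epsilon> \<phi>1) (\<epsilon> \<phi>2)"]) (use pos bound in \<open>auto simp: min_le_iff_disj\<close>)
qed

lemma fox_kernel_half_lines:
  "\<exists>C X0. \<forall>s. Im s = \<phi>1 \<or> Im s = \<phi>2 \<longrightarrow> Re s \<le> X0 \<longrightarrow> norm (\<H> s) \<le> exp (- C * Re s)"
proof -
  have "\<exists>C X0. \<forall>s\<in>{s. Im s = \<phi>1 \<or> Im s = \<phi>2}. Re s \<le> X0 \<longrightarrow> norm (\<H> s) \<le> exp (- C * Re s)"
    using half_lines_sin_bound
    by (intro fox_kernel_left_bound[where Y = "max \<bar>\<phi>1\<bar> \<bar>\<phi>2\<bar>"] m_le_q n_le_p \<alpha>_pos \<beta>_pos Delta_nonneg)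
       auto
  thus ?thesis by simp
qed

text \<open>What the truncation leaves are two tails and the closing segment. V is a separate
  parameter since in \<open>loop_integral_expansion\<close> it comes from compactness at one X, and
  in \<open>loop_integral_eq_0\<close> from an exponential bound available for every small
  X.\<close>

lemma loop_integral_truncation_error:
  assumes C: "\<And>s. Im s = \<phi>1 \<or> Im s = \<phi>2 \<Longrightarrow> Re s \<le> X0 \<Longrightarrow> norm (\<H> s) \<le> exp (- C * Re s)"
    and X: "X \<le> X0" "X < R" "path_image (closed_loop X) \<inter> poles = {}"
    and z: "z \<noteq> 0" "ln (norm z) \<le> - C - 1"
    and V: "\<And>s. Re s = X \<Longrightarrow> \<phi>1 \<le> Im s \<Longrightarrow> Im s \<le> \<phi>2 \<Longrightarrow> norm (\<H> s) \<le> V" "V \<ge> 0"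
  shows "norm (loop_integral \<phi>1 \<phi>2 R g (integrand z) - contour_integral (closed_loop X) (integrand z)) \<le>
    exp (arg_bound * (\<bar>\<phi>1\<bar> + \<bar>\<phi>2\<bar>)) * (2 * exp (- C * X) + V * (\<phi>2 - \<phi>1)) * norm z powr (- X)"
proof -
  define E where "E = exp (arg_bound * (\<bar>\<phi>1\<bar> + \<bar>\<phi>2\<bar>))"
  define c where "c = - (C + ln (norm z))"
  have c: "c \<ge> 1" using z by (simp add: c_def)
  have pow: "norm (branch_pow lg z (- s)) \<le> E * norm z powr (- Re s)"
    if "\<phi>1 \<le> Im s" "Im s \<le> \<phi>2" for s
  proof -
    have "arg_bound * \<bar>Im s\<bar> \<le> arg_bound * (\<bar>\<phi>1\<bar> + \<bar>\<phi>2\<bar>)" using that arg_bound_nonneg by (intro mult_left_mono) auto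
    hence "exp (arg_bound * \<bar>Im (- s)\<bar>) \<le> E" by (simp add: E_def)
    hence "exp (arg_bound * \<bar>Im (- s)\<bar>) * norm z powr Re (- s) \<le> E * norm z powr Re (- s)"
      by (rule mult_right_mono) auto
    thus ?thesis using norm_branch_pow_le[OF z(1), of "- s"] by simp
  qed
  have powr_eq: "exp (- C * x) * norm z powr (- x) = exp (c * x)" for x
    using z by (simp add: powr_def c_def algebra_simps flip: exp_add)
  have seg: "Complex x \<phi> \<notin> poles" if "x \<le> R" "\<phi> = \<phi>1 \<or> \<phi> = \<phi>2" for x \<phi>
    using poles_avoid(2)[of "Complex x \<phi>"] that by auto
  have half: "integral {..R} (\<lambda>x. integrand z (Complex x \<phi>)) =
      integral {..X} (\<lambda>x. integrand z (Complex x \<phi>)) + integral {X..R} (\<lambda>x. integrand z (Complex x \<phi>))"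
    "norm (integral {..X} (\<lambda>x. integrand z (Complex x \<phi>))) \<le> E * exp (c * X)"
    if \<phi>': "\<phi> = \<phi>1 \<or> \<phi> = \<phi>2" for \<phi>
  proof -
    have "continuous_on {s. Im s = \<phi> \<and> Re s \<le> R} (integrand z)"
      using poles_avoid(2) \<phi>' by (intro holomorphic_on_imp_continuous_on holomorphic_integrand) force
    hence cont: "continuous_on {..R} (\<lambda>x. integrand z (Complex x \<phi>))"
      by (rule continuous_on_compose2) (auto intro!: continuous_intros)
    have bound: "norm (integrand z (Complex x \<phi>)) \<le> E * exp (c * x)" if "x \<le> X" for x
    proof -
      have "norm (integrand z (Complex x \<phi>)) \<le> exp (- C * x) * (E * norm z powr (- x))"
        unfolding norm_mult using C[of "Complex x \<phi>"] pow[of "Complex x \<phi>"] \<phi>_less \<phi>' that X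
        by (intro mult_mono) auto
      also have "\<dots> = E * (exp (- C * x) * norm z powr (- x))" by simp
      finally show ?thesis unfolding powr_eq .
    qed
    have "norm (integral {..X} (\<lambda>x. integrand z (Complex x \<phi>))) \<le> E * exp (c * X) / c"
      using half_line_integral_bound(2)[OF cont _ _ bound] X c by simp
    also have "\<dots> \<le> E * exp (c * X) / 1" using c by (intro divide_left_mono) (auto simp: E_def)
    finally show "norm (integral {..X} (\<lambda>x. integrand z (Complex x \<phi>))) \<le> E * exp (c * X)" by simp
    show "integral {..R} (\<lambda>x. integrand z (Complex x \<phi>)) =
      integral {..X} (\<lambda>x. integrand z (Complex x \<phi>)) + integral {X..R} (\<lambda>x. integrand z (Complex x \<phi>))"
      using half_line_integral_bound(1)[OF cont _ _ bound] X c by simp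
  qed
  define W where "W = contour_integral (linepath (Complex X \<phi>1) (Complex X \<phi>2)) (integrand z)"
  have W: "norm W \<le> (V * (E * norm z powr (- X))) * norm (Complex X \<phi>2 - Complex X \<phi>1)"
    unfolding W_def
  proof (rule contour_integral_bound_linepath)
    have "closed_segment (Complex X \<phi>1) (Complex X \<phi>2) \<subseteq> path_image (closed_loop X)"
      unfolding truncated_loop_simps(3)[OF loop_path] by (auto simp: closed_segment_commute)
    hence "continuous_on (closed_segment (Complex X \<phi>1) (Complex X \<phi>2)) (integrand z)"
      using X(3) by (intro holomorphic_on_imp_continuous_on holomorphic_integrand) auto
    thus "integrand z contour_integrable_on linepath (Complex X \<phi>1) (Complex X \<phi>2)"
      by (rule contour_integrable_continuous_linepath)
    show "norm (integrand z s) \<le> V * (E * norm z powr (- X))"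
      if "s \<in> closed_segment (Complex X \<phi>1) (Complex X \<phi>2)" for s
      using that V(1)[of s] pow[of s] V(2) \<phi>_less unfolding norm_mult
      by (intro mult_mono) (auto simp: closed_segment_vertical closed_segment_eq_real_ivl)
  qed (use V in \<open>auto simp: E_def\<close>)
  have "norm (Complex X \<phi>2 - Complex X \<phi>1) = \<phi>2 - \<phi>1"
    using \<phi>_less by (simp add: complex_diff cmod_def)
  note W = W[unfolded this]
  \<comment> \<open>The path g and the horizontal pieces right of X cancel. W gets a plus sign
    because the closed loop runs down the segment.\<close>
  have "loop_integral \<phi>1 \<phi>2 R g (integrand z) - contour_integral (closed_loop X) (integrand z) =
    integral {..X} (\<lambda>x. integrand z (Complex x \<phi>1)) - integral {..X} (\<lambda>x. integrand z (Complex x \<phi>2)) + W"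
  proof -
    have "contour_integral (closed_loop X) (integrand z) =
      integral {X..R} (\<lambda>x. integrand z (Complex x \<phi>1)) + contour_integral g (integrand z)
      - integral {X..R} (\<lambda>x. integrand z (Complex x \<phi>2)) - W"
      unfolding W_def
      by (subst contour_integral_truncated_loop[OF loop_path open_Compl_poles holomorphic_integrand])
         (use X(3) in \<open>auto simp: contour_integral_horizontal[OF X(2)]\<close>)
    thus ?thesis unfolding loop_integral_def using half(1)[of \<phi>1] half(1)[of \<phi>2] by simp
  qed
  also have "norm \<dots> \<le> (E * exp (c * X) + E * exp (c * X)) + V * (E * norm z powr (- X)) * (\<phi>2 - \<phi>1)"
    using half(2)[of \<phi>1] half(2)[of \<phi>2] W
    by (intro norm_triangle_le add_mono norm_triangle_le_diff) auto
  also have "\<dots> = E * (2 * exp (- C * X) + V * (\<phi>2 - \<phi>1)) * norm z powr (- X)"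
    unfolding powr_eq[symmetric] by (simp add: algebra_simps)
  finally show ?thesis unfolding E_def .
qed

text \<open>The order N cannot be prescribed, since the cut at -N has to avoid the real parts of the
  poles; exceeding M is enough for an expansion to order M.\<close>

lemma loop_integral_expansion:
  obtains N K r where "N > M" "r > 0" "\<And>z. z \<noteq> 0 \<Longrightarrow> norm z < r \<Longrightarrow>
    norm (loop_integral \<phi>1 \<phi>2 R g (integrand z) - 2 * of_real pi * \<i> * residue_sum N z) \<le> K * norm z powr N"
proof -
  obtain X1 where X1: "X1 < R" "\<And>s. s \<in> path_image g \<Longrightarrow> X1 < Re s"
    "\<And>w. w \<in> right_poles n a \<alpha> \<Longrightarrow> X1 < Re w"
    using left_bounds by blast
  obtain C X0 where C: "\<And>s. Im s = \<phi>1 \<or> Im s = \<phi>2 \<Longrightarrow> Re s \<le> X0 \<Longrightarrow> norm (\<H> s) \<le> exp (- C * Re s)"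
    using fox_kernel_half_lines by blast
  \<comment> \<open>Left of X0 the kernel bound holds on the half-lines, left of X1 there are
    neither right poles nor points of g, and X < -M gives N > M.\<close>
  define B where "B = min (min X0 X1) (- M)"
  \<comment> \<open>Countably many real parts cannot fill an interval, so some cut is free of left
    poles.\<close>
  have "countable (Re ` left_poles m b \<beta>)"
    unfolding left_poles_eq by (intro countable_image countable_SIGMA) auto
  moreover have "uncountable {B - 1<..<B}" by (simp add: uncountable_open_interval)
  ultimately have "\<not> {B - 1<..<B} \<subseteq> Re ` left_poles m b \<beta>"
    using countable_subset by blast
  then obtain X where X: "X < B" "X \<notin> Re ` left_poles m b \<beta>"
    by (auto simp: subset_iff)
  have XX: "X \<le> X0" "X < R" "\<And>s. s \<in> path_image g \<Longrightarrow> X < Re s" "\<And>w. w \<in> poles \<Longrightarrow> Re w \<noteq> X"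
    using X X1 unfolding B_def by fastforce+
  have closed_loop: "path_image (closed_loop X) \<inter> poles = {}"
    "contour_integral (closed_loop X) (integrand z) = 2 * of_real pi * \<i> * residue_sum (- X) z" for z
    by (rule contour_integral_closed_loop[OF XX(2-4)]; assumption)+
  have "closed_segment (Complex X \<phi>1) (Complex X \<phi>2) \<inter> poles = {}"
    using XX(4) by (auto simp: closed_segment_vertical)
  hence "compact (\<H> ` closed_segment (Complex X \<phi>1) (Complex X \<phi>2))"
    by (intro compact_continuous_image holomorphic_on_imp_continuous_on holomorphic_fox_kernel) auto
  then obtain V where V: "V > 0" "\<And>s. s \<in> closed_segment (Complex X \<phi>1) (Complex X \<phi>2) \<Longrightarrow> norm (\<H> s) \<le> V"
    by (metis bounded_pos compact_imp_bounded imageI)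
  have V': "norm (\<H> s) \<le> V" if "Re s = X" "\<phi>1 \<le> Im s" "Im s \<le> \<phi>2" for s
    using V(2)[of s] that by (simp add: closed_segment_vertical closed_segment_eq_real_ivl)
  define K where "K = exp (arg_bound * (\<bar>\<phi>1\<bar> + \<bar>\<phi>2\<bar>)) * (2 * exp (- C * X) + V * (\<phi>2 - \<phi>1))"
  show thesis
  proof (rule that[of "- X" "exp (- C - 1)" K])
    fix z :: complex assume z: "z \<noteq> 0" "norm z < exp (- C - 1)"
    have lnz: "ln (norm z) \<le> - C - 1" using z by (metis ln_exp ln_le_cancel_iff exp_gt_zero less_imp_le zero_less_norm_iff)
    have "norm (loop_integral \<phi>1 \<phi>2 R g (integrand z) - contour_integral (closed_loop X) (integrand z)) \<le> K * norm z powr (- X)"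
      unfolding K_def
      by (rule loop_integral_truncation_error[OF C XX(1,2) closed_loop(1) z(1) lnz V' less_imp_le[OF V(1)]])
    thus "norm (loop_integral \<phi>1 \<phi>2 R g (integrand z) - 2 * of_real pi * \<i> * residue_sum (- X) z) \<le> K * norm z powr (- X)"
      unfolding closed_loop(2) .
  qed (use X in \<open>auto simp: B_def\<close>)
qed

text \<open>Without left poles the truncation error bounds the whole integral, for every truncation point.\<close>

lemma loop_integral_eq_0:
  assumes "m = 0"
  obtains r where "r > 0" "\<And>z. z \<noteq> 0 \<Longrightarrow> norm z < r \<Longrightarrow> loop_integral \<phi>1 \<phi>2 R g (integrand z) = 0"
proof -
  obtain X1 where X1: "X1 < R" "\<And>s. s \<in> path_image g \<Longrightarrow> X1 < Re s"
    "\<And>w. w \<in> right_poles n a \<alpha> \<Longrightarrow> X1 < Re w"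
    using left_bounds by blast
  \<comment> \<open>Without left poles the sine condition is void, so the exponential bound holds in
    the whole strip, with constants that do not depend on the cut.\<close>
  have "\<exists>C X0. \<forall>s\<in>{s. \<phi>1 \<le> Im s \<and> Im s \<le> \<phi>2}. Re s \<le> X0 \<longrightarrow> norm (\<H> s) \<le> exp (- C * Re s)"
    using assms
    by (intro fox_kernel_left_bound[where Y = "max \<bar>\<phi>1\<bar> \<bar>\<phi>2\<bar>"] m_le_q n_le_p \<alpha>_pos \<beta>_pos Delta_nonneg)
       auto
  then obtain C X0 where C: "\<And>s. \<phi>1 \<le> Im s \<Longrightarrow> Im s \<le> \<phi>2 \<Longrightarrow> Re s \<le> X0 \<Longrightarrow> norm (\<H> s) \<le> exp (- C * Re s)"
    by blast
  have C': "norm (\<H> s) \<le> exp (- C * Re s)" if "Im s = \<phi>1 \<or> Im s = \<phi>2" "Re s \<le> X0" for s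
    using C that \<phi>_less by (metis less_imp_le order_refl)
  \<comment> \<open>K is free of X: with exp (- C X) as bound on the segment, the error depends on X
    only through exp (c X), which tends to 0 at -\<infinity>.\<close>
  define K where "K = exp (arg_bound * (\<bar>\<phi>1\<bar> + \<bar>\<phi>2\<bar>)) * (2 + (\<phi>2 - \<phi>1))"
  show thesis
  proof (rule that[of "exp (- C - 1)"])
    fix z :: complex assume z: "z \<noteq> 0" "norm z < exp (- C - 1)"
    have lnz: "ln (norm z) \<le> - C - 1" using z by (metis ln_exp ln_le_cancel_iff exp_gt_zero less_imp_le zero_less_norm_iff)
    define L where "L = loop_integral \<phi>1 \<phi>2 R g (integrand z)"
    define c where "c = - (C + ln (norm z))"
    have c: "c > 0" using lnz by (simp add: c_def)
    have "\<forall>\<^sub>F X in at_bot. norm L \<le> K * exp (c * X)"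
      using eventually_gt_at_bot[of "min X0 X1"]
    proof eventually_elim
      case (elim X)
      have XX: "X \<le> X0" "X < R" "\<And>s. s \<in> path_image g \<Longrightarrow> X < Re s"
        using elim X1 by fastforce+
      have "left_poles m b \<beta> = {}" using assms by (simp add: left_poles_def)
      hence off: "Re w \<noteq> X" if "w \<in> poles" for w
        using that elim X1(3)[of w] by auto
      have closed_loop: "path_image (closed_loop X) \<inter> poles = {}"
        "contour_integral (closed_loop X) (integrand z) = 2 * of_real pi * \<i> * residue_sum (- X) z"
        by (rule contour_integral_closed_loop[OF XX(2,3) off]; assumption)+
      have zero: "contour_integral (closed_loop X) (integrand z) = 0"
        unfolding closed_loop(2) residue_sum_def using assms by simp
      have V: "norm (\<H> s) \<le> exp (- C * X)" if "Re s = X" "\<phi>1 \<le> Im s" "Im s \<le> \<phi>2" for s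
        using C[of s] that XX(1) by simp
      have "norm L \<le> exp (arg_bound * (\<bar>\<phi>1\<bar> + \<bar>\<phi>2\<bar>)) * (2 * exp (- C * X) + exp (- C * X) * (\<phi>2 - \<phi>1)) * norm z powr (- X)"
        using loop_integral_truncation_error[OF C' XX(1,2) closed_loop(1) z(1) lnz V] zero
        by (simp add: L_def)
      also have "\<dots> = K * (exp (- C * X) * norm z powr (- X))"
        by (simp add: K_def algebra_simps)
      also have "exp (- C * X) * norm z powr (- X) = exp (c * X)"
        using z by (simp add: powr_def c_def algebra_simps flip: exp_add)
      finally show ?case .
    qed
    moreover have "((\<lambda>X. K * exp (c * X)) \<longlongrightarrow> 0) at_bot" using c by real_asymp
    ultimately have "norm L \<le> 0" by (intro tendsto_lowerbound[of _ 0 at_bot]) auto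
    thus "loop_integral \<phi>1 \<phi>2 R g (integrand z) = 0" by (simp add: L_def)
  qed auto
qed

section \<open>The H-function near zero\<close>

abbreviation H :: "complex \<Rightarrow> complex" where
  "H \<equiv> fox_H m n p q a \<alpha> b \<beta> \<phi>1 \<phi>2 R g lg"

text \<open>A punctured neighbourhood of 0 lies in \<open>fox_domain\<close>, for \<Delta> = 0
  because \<delta> > 0; the dummy value does not enter.\<close>

lemma eventually_fox_H:
  "\<forall>\<^sub>F z in at 0. H z = loop_integral \<phi>1 \<phi>2 R g (integrand z) / (2 * of_real pi * \<i>)"
proof -
  have "fox_delta p q \<alpha> \<beta> > 0"
    unfolding fox_delta_def
    by (intro mult_pos_pos prod_pos) (use \<alpha>_pos \<beta>_pos in \<open>force simp: powr_gt_zero\<close>)+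
  hence "\<forall>\<^sub>F z in at 0. z \<in> ball 0 (fox_delta p q \<alpha> \<beta>) - {0}"
    by (intro eventually_at_in_open) auto
  thus ?thesis
    by eventually_elim (use Delta_nonneg in \<open>auto simp: fox_H_def fox_domain_def\<close>)
qed

lemma branch_pow_bigtheta:
  "(\<lambda>z. branch_pow lg z c) \<in> \<Theta>[at 0](norm_powr (Re c))"
proof (rule bigthetaI)
  show "(\<lambda>z. branch_pow lg z c) \<in> O[at 0](norm_powr (Re c))"
    by (rule bigoI[where c = "exp (arg_bound * \<bar>Im c\<bar>)"])
       (simp add: eventually_at_filter norm_branch_pow_le)
  show "(\<lambda>z. branch_pow lg z c) \<in> \<Omega>[at 0](norm_powr (Re c))"
    by (rule landau_omega.bigI[where c = "exp (- (arg_bound * \<bar>Im c\<bar>))"])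
       (simp_all add: eventually_at_filter norm_branch_pow_ge)
qed

text \<open>The remainder is known to order N > M. The terms with real exponents strictly between M
  and N are finitely many, each is o(|z|^M), and they move to the remainder.\<close>

lemma asymptotic_expansion:
  "asymptotic_expansion_at_0 lg H index_set rcoeff expo"
  unfolding asymptotic_expansion_at_0_def
proof (intro allI conjI)
  fix M :: real
  show "finite {i \<in> index_set. Re (expo i) \<le> M}" by (rule finite_expo_le)
  obtain N K r where N: "N > M" "r > 0" "\<And>z. z \<noteq> 0 \<Longrightarrow> norm z < r \<Longrightarrow>
    norm (loop_integral \<phi>1 \<phi>2 R g (integrand z) - 2 * of_real pi * \<i> * residue_sum N z) \<le> K * norm z powr N"
    by (rule loop_integral_expansion[of M]) (rule that)
  define T where "T = {i \<in> index_set. M < Re (expo i) \<and> Re (expo i) < N}"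
  have "finite T" unfolding T_def by (rule finite_subset[OF _ finite_expo_less[of N]]) auto
  have sum_split: "residue_sum N z = (\<Sum>i | i \<in> index_set \<and> Re (expo i) \<le> M. rcoeff i * branch_pow lg z (expo i))
      + (\<Sum>i\<in>T. rcoeff i * branch_pow lg z (expo i))" for z
  proof -
    have "{i \<in> index_set. Re (expo i) < N} = {i \<in> index_set. Re (expo i) \<le> M} \<union> T"
      unfolding T_def using N(1) by auto
    moreover have "{i \<in> index_set. Re (expo i) \<le> M} \<inter> T = {}" unfolding T_def by auto
    ultimately show ?thesis
      unfolding residue_sum_def by (simp only: sum.union_disjoint finite_expo_le \<open>finite T\<close>)
  qed
  have "\<forall>\<^sub>F z in at 0. z \<in> ball 0 r - {0}" using N(2) by (intro eventually_at_in_open) auto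
  hence "\<forall>\<^sub>F z in at 0. norm (H z - residue_sum N z) \<le> (K / (2 * pi)) * norm (norm_powr N z)"
    using eventually_fox_H
  proof eventually_elim
    case (elim z)
    have "H z - residue_sum N z =
        (loop_integral \<phi>1 \<phi>2 R g (integrand z) - 2 * of_real pi * \<i> * residue_sum N z) / (2 * of_real pi * \<i>)"
      unfolding elim(2) by (simp add: field_simps)
    also have "norm \<dots> \<le> (K * norm z powr N) / (2 * pi)"
      unfolding norm_divide using N(3)[of z] elim(1) by (simp add: norm_mult divide_right_mono)
    finally show ?case by simp
  qed
  hence "(\<lambda>z. H z - residue_sum N z) \<in> O[at 0](norm_powr N)"
    by (rule bigoI)
  also have "norm_powr N \<in> o[at 0](norm_powr M)"
    by (rule norm_powr_smallo[OF N(1)])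
  finally have 1: "(\<lambda>z. H z - residue_sum N z) \<in> o[at 0](norm_powr M)" .
  have 2: "(\<lambda>z. \<Sum>i\<in>T. rcoeff i * branch_pow lg z (expo i)) \<in> o[at 0](norm_powr M)"
  proof (intro big_sum_in_smallo)
    fix i assume i: "i \<in> T"
    have "(\<lambda>z. rcoeff i * branch_pow lg z (expo i)) \<in> O[at 0](norm_powr (Re (expo i)))"
      using branch_pow_bigtheta[of "expo i"] by (auto intro: bigthetaD1)
    also have "norm_powr (Re (expo i)) \<in> o[at 0](norm_powr M)"
      using i by (intro norm_powr_smallo) (simp add: T_def)
    finally show "(\<lambda>z. rcoeff i * branch_pow lg z (expo i)) \<in> o[at 0](norm_powr M)" .
  qed
  have "(\<lambda>z. (H z - residue_sum N z) + (\<Sum>i\<in>T. rcoeff i * branch_pow lg z (expo i))) \<in> o[at 0](norm_powr M)"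
    by (rule sum_in_smallo[OF 1 2])
  thus "(\<lambda>z. norm (H z - (\<Sum>i | i \<in> index_set \<and> Re (expo i) \<le> M. rcoeff i * branch_pow lg z (expo i))))
      \<in> o[at 0](\<lambda>z. norm z powr M)"
    unfolding sum_split norm_smallo_iff by (simp add: algebra_simps)
qed

text \<open>Cut the expansion at an order M not below Re ((b j + 1) / \<beta> j) for any j. The
  terms with l \<ge> 1 go to their own r j, and the common remainder, being O(|z|^M), can be charged
  to any single j. For m = 0 no j is available and H itself has to vanish near 0.\<close>

lemma leading_terms:
  "\<exists>r. (\<forall>j\<in>{1..m}. r j \<in> O[at 0](\<lambda>z. branch_pow lg z (expo (j, 1)))) \<and>
     (\<forall>\<^sub>F z in at 0. H z = (\<Sum>j=1..m. rcoeff (j, 0) * branch_pow lg z (expo (j, 0)) + r j z))"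
proof (cases "m = 0")
  case True
  obtain r where r: "r > 0" "\<And>z. z \<noteq> 0 \<Longrightarrow> norm z < r \<Longrightarrow> loop_integral \<phi>1 \<phi>2 R g (integrand z) = 0"
    by (rule loop_integral_eq_0[OF True]) (rule that)
  have "\<forall>\<^sub>F z in at 0. z \<in> ball 0 r - {0}" using r(1) by (intro eventually_at_in_open) auto
  hence "\<forall>\<^sub>F z in at 0. H z = 0"
    using eventually_fox_H by eventually_elim (use r(2) in auto)
  thus ?thesis using True by auto
next
  case False
  \<comment> \<open>The sum of the absolute values dominates the real parts of all second
    exponents.\<close>
  define M where "M = (\<Sum>j=1..m. \<bar>Re (expo (j, 1))\<bar>)"
  have M: "Re (expo (j, 1)) \<le> M" if "j \<in> {1..m}" for j
  proof -
    have "\<bar>Re (expo (j, 1))\<bar> \<le> M" unfolding M_def by (rule member_le_sum[OF that]) auto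
    thus ?thesis by linarith
  qed
  define L where "L = (\<lambda>j. {l. Re (expo (j, l)) \<le> M})"
  define rem where "rem = (\<lambda>z. H z - (\<Sum>i | i \<in> index_set \<and> Re (expo i) \<le> M. rcoeff i * branch_pow lg z (expo i)))"
  \<comment> \<open>The common remainder is charged to j = 1, an index that exists since m >
    0.\<close>
  define r where "r = (\<lambda>j z. (\<Sum>l\<in>L j - {0}. rcoeff (j, l) * branch_pow lg z (expo (j, l))) + (if j = 1 then rem z else 0))"
  have L_eq: "{i \<in> index_set. Re (expo i) \<le> M} = Sigma {1..m} L"
    unfolding L_def by auto
  have mono: "Re (expo (j, l)) \<le> Re (expo (j, l'))" if "j \<in> {1..m}" "l \<le> l'" for j l l'
    using \<beta>_pos'[OF that(1)] that(2) by (simp add: expo_def divide_right_mono)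
  have L: "finite (L j)" "0 \<in> L j" if j: "j \<in> {1..m}" for j
  proof -
    have "finite (Sigma {1..m} L)" using finite_expo_le[of M] unfolding L_eq .
    moreover have "L j = snd ` (Sigma {1..m} L \<inter> {j} \<times> UNIV)" using j by force
    ultimately show "finite (L j)" by simp
    show "0 \<in> L j" using M[OF j] mono[OF j, of 0 1] by (simp add: L_def)
  qed
  have "rem \<in> o[at 0](norm_powr M)"
    using asymptotic_expansion unfolding asymptotic_expansion_at_0_def rem_def
    by (simp only: norm_smallo_iff)
  hence rem: "rem \<in> O[at 0](norm_powr M)" by (rule landau_o.small_imp_big)
  have to_branch: "f \<in> O[at 0](\<lambda>z. branch_pow lg z (expo (j, 1)))"
    if "f \<in> O[at 0](norm_powr u)" "Re (expo (j, 1)) \<le> u" for f :: "complex \<Rightarrow> complex" and u j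
  proof -
    note that(1)
    also have "norm_powr u \<in> O[at 0](norm_powr (Re (expo (j, 1))))"
      using that(2) by (rule norm_powr_bigo)
    also have "norm_powr (Re (expo (j, 1))) \<in> O[at 0](\<lambda>z. branch_pow lg z (expo (j, 1)))"
      using branch_pow_bigtheta[of "expo (j, 1)"] by (metis bigthetaD1 bigtheta_sym)
    finally show ?thesis .
  qed
  have "r j \<in> O[at 0](\<lambda>z. branch_pow lg z (expo (j, 1)))" if j: "j \<in> {1..m}" for j
    unfolding r_def
  proof (intro sum_in_bigo big_sum_in_bigo)
    fix l assume l: "l \<in> L j - {0}"
    have "(\<lambda>z. rcoeff (j, l) * branch_pow lg z (expo (j, l))) \<in> O[at 0](norm_powr (Re (expo (j, l))))"
      using branch_pow_bigtheta[of "expo (j, l)"] by (auto intro: bigthetaD1)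
    thus "(\<lambda>z. rcoeff (j, l) * branch_pow lg z (expo (j, l))) \<in> O[at 0](\<lambda>z. branch_pow lg z (expo (j, 1)))"
      by (rule to_branch) (use l mono[OF j, of 1 l] in auto)
  qed (use to_branch[OF rem M[OF j]] in \<open>cases "j = 1"; auto\<close>)
  moreover have "H z = (\<Sum>j=1..m. rcoeff (j, 0) * branch_pow lg z (expo (j, 0)) + r j z)" for z
  proof -
    have "(\<Sum>j=1..m. rcoeff (j, 0) * branch_pow lg z (expo (j, 0)) + r j z) =
        (\<Sum>j=1..m. (\<Sum>l\<in>L j. rcoeff (j, l) * branch_pow lg z (expo (j, l))) + (if j = 1 then rem z else 0))"
      using L by (intro sum.cong refl) (simp add: r_def sum.remove[of _ 0])
    also have "\<dots> = (\<Sum>j=1..m. \<Sum>l\<in>L j. rcoeff (j, l) * branch_pow lg z (expo (j, l))) + rem z"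
      using False by (simp add: sum.distrib)
    also have "(\<Sum>j=1..m. \<Sum>l\<in>L j. rcoeff (j, l) * branch_pow lg z (expo (j, l))) =
        (\<Sum>i\<in>Sigma {1..m} L. rcoeff i * branch_pow lg z (expo i))"
      using L by (subst sum.Sigma) (auto simp: case_prod_unfold)
    also have "\<dots> + rem z = H z" unfolding rem_def L_eq by simp
    finally show ?thesis by simp
  qed
  ultimately show ?thesis by (intro exI[of _ r]) auto
qed

end

theorem corollary2:
  fixes m n p q :: nat
    and a b :: "nat \<Rightarrow> complex" and \<alpha> \<beta> :: "nat \<Rightarrow> real"
    and \<phi>1 \<phi>2 R :: real and g :: "real \<Rightarrow> complex"
    and lg :: "complex \<Rightarrow> complex"
  assumes "m \<le> q" and "n \<le> p"
    and "\<And>i. i \<in> {1..p} \<Longrightarrow> \<alpha> i > 0"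
    and "\<And>j. j \<in> {1..q} \<Longrightarrow> \<beta> j > 0"
    and "\<And>i j k l :: nat. i \<in> {1..n} \<Longrightarrow> j \<in> {1..m} \<Longrightarrow>
           of_real (\<beta> j) * (a i - 1 - of_nat k) \<noteq> of_real (\<alpha> i) * (b j + of_nat l)"
    and "\<And>i j k l :: nat. i \<in> {1..m} \<Longrightarrow> j \<in> {1..m} \<Longrightarrow> i \<noteq> j \<Longrightarrow>
           of_real (\<beta> j) * (b i + of_nat k) \<noteq> of_real (\<beta> i) * (b j + of_nat l)"
    and "fox_Delta p q \<alpha> \<beta> \<ge> 0"
    and "fox_loop m n a \<alpha> b \<beta> \<phi>1 \<phi>2 R g"
    and "log_branch lg"
  shows "asymptotic_expansion_at_0 lg (fox_H m n p q a \<alpha> b \<beta> \<phi>1 \<phi>2 R g lg)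
           ({1..m} \<times> (UNIV :: nat set))
           (\<lambda>(j, l). fox_coeff m n p q a \<alpha> b \<beta> j l)
           (\<lambda>(j, l). (b j + of_nat l) / of_real (\<beta> j)) \<and>
         (\<exists>r :: nat \<Rightarrow> complex \<Rightarrow> complex.
           (\<forall>j\<in>{1..m}. r j \<in> O[at 0](\<lambda>z. branch_pow lg z ((b j + 1) / of_real (\<beta> j)))) \<and>
           (\<forall>\<^sub>F z in at 0.
              fox_H m n p q a \<alpha> b \<beta> \<phi>1 \<phi>2 R g lg z =
              (\<Sum>j=1..m. (fox_coeff m n p q a \<alpha> b \<beta> j 0 * branch_pow lg z (b j / of_real (\<beta> j))
                         + r j z)))) \<and>
         (\<forall>j\<in>{1..m}.
           fox_coeff m n p q a \<alpha> b \<beta> j 0 =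
           1 / of_real (\<beta> j) *
           (((\<Prod>i\<in>{1..m}-{j}. Gamma (b i - b j * of_real (\<beta> i) / of_real (\<beta> j))) *
             (\<Prod>i=1..n. Gamma (1 - a i + b j * of_real (\<alpha> i) / of_real (\<beta> j)))) *
            ((\<Prod>i=n+1..p. rGamma (a i - b j * of_real (\<alpha> i) / of_real (\<beta> j))) *
             (\<Prod>i=m+1..q. rGamma (1 - b i + b j * of_real (\<beta> i) / of_real (\<beta> j))))))"
proof -
  interpret fox_integral m n p q a b \<alpha> \<beta> \<phi>1 \<phi>2 R g lg
    using assms by unfold_locales
  have exponents: "(b j + of_nat 0) / of_real (\<beta> j) = b j / of_real (\<beta> j)"
    "(b j + of_nat 1) / of_real (\<beta> j) = (b j + 1) / of_real (\<beta> j)" for j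
    by simp_all
  show ?thesis
  proof (intro conjI)
    show "asymptotic_expansion_at_0 lg H index_set
        (\<lambda>(j, l). fox_coeff m n p q a \<alpha> b \<beta> j l) (\<lambda>(j, l). (b j + of_nat l) / of_real (\<beta> j))"
      using asymptotic_expansion unfolding expo_def rcoeff_def .
  next
    show "\<exists>r. (\<forall>j\<in>{1..m}. r j \<in> O[at 0](\<lambda>z. branch_pow lg z ((b j + 1) / of_real (\<beta> j)))) \<and>
      (\<forall>\<^sub>F z in at 0. H z = (\<Sum>j=1..m.
        (fox_coeff m n p q a \<alpha> b \<beta> j 0 * branch_pow lg z (b j / of_real (\<beta> j)) + r j z)))"
      using leading_terms unfolding expo_def rcoeff_def prod.case exponents .
  qed (simp add: fox_coeff_def mult.assoc)
qed

end
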